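(* Let $M\in\mathbb N$, $L>0$, and let $F\in \mathrm{Lip}([a,b],L)\cap\mathcal F([a,b],M)$. For each $N$, let $\tilde F_N$ be the approximated metric polynomial interpolant (the output of the algorithm described in the context) computed from the samples $\{F(x_i)\}_{i=0}^N$ of $F$ at the $N+1$ Chebyshev points $x_0<\dots<x_N$ of $[a,b]$. Then for $x\in[a,b]$ $$d_H(\tilde F_N(x),F(x))=O\Big(\frac{\log N}{N}\Big)\quad\text{as } N\to\infty,$$ with the implied constant independent of $x$.
   Context: **Set-valued functions.** $d_H$ is the Hausdorff metric on compact non-empty subsets of $\mathbb R$. $K^*(\mathbb R)$ is the family of non-empty finite unions of compact intervals of $\mathbb R$. A set-valued function (SVF) here is a map $F:[a,b]\to K^*(\mathbb R)$; $\mathrm{Graph}(F)=\{(x,y):x\in[a,b],y\in F(x)\}$. $F\in \mathrm{Lip}([a,b],L)$ means $d_H(F(x),F(y))\le L|x-y|$ for all $x,y\in[a,b]$. $u(x)=\max F(x)$ and $\ell(x)=\min F(x)$ are the upper and lower boundaries of $F$. A hole of $F$ is a set $H=\{(x,y): g(x)<y<h(x),\ x\in(c,d)\}\not\subset \mathrm{Graph}(F)$, where $g,h:[c,d]\to\mathbb R$ satisfy $g(c)=h(c)$, $g(d)=h(d)$ and $g(x),h(x)\in F(x)$ on $[c,d]$. The points $(c,g(c))$, $(d,g(d))$ are its points of change of topology (PCTs). **Class $\mathcal F([a,b],M)$.** $F\in\mathcal F([a,b],M)$ means: (1) $\mathrm{Graph}(F)$ has $M$ holes $H_1,\dots,H_M$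 with pairwise disjoint closures; (2) $H_i$ lies over $[c_i,d_i]\subset(a,b)$, has lower and upper boundary functions $g_i,h_i$, and is the interior of a closed curve $\Gamma_i$ cut by each vertical line at $x\in(c_i,d_i)$ in exactly two points; (3) the curves $\Gamma_i$ do not meet the graphs of $u$ and $\ell$; (4) $F(a)$ and $F(b)$ are convex. **Representation by boundary functions.** Let $I(x)=\{i: x\in[c_i,d_i]\}$, $J=\#I(x)$. If $J=0$, $F(x)=[\ell(x),u(x)]$. If $J>0$, order $I(x)=\{i_1,\dots,i_J\}$ so that $g_{i_1}(x),\dots,g_{i_J}(x)$ are in ascending order; then $$F(x)=[\ell(x),g_{i_1}(x)]\cup\bigcup_{j=1}^{J-1}[h_{i_j}(x),g_{i_{j+1}}(x)]\cup[h_{i_J}(x),u(x)].\qquad( * )$$ **Chebyshev points.** $x_0<\dots<x_N$ are the roots of the Chebyshev polynomial of the first kind of degree $N+1$, transported affinely to $[a,b]$. **Metric chains.** For compact $V,W$, $\Pi_V(w)=\{v\in V:|v-w|=d(w,V)\}$ and $\Pi(V,W)=\{(v,w)\in V\times W: v\in\Pi_V(w)\text{ or }w\in\Pi_W(v)\}$ (metric pairs). A metric chain of $\{F(x_i)\}_{i=0}^N$ is a tuple $(f_0,\dots,f_N)$ with $(f_i,f_{i+1})\in\Pi(F(x_i),F(x_{i+1}))$ for $0\le i\le N-1$. **Significant metric chains.** Write $F(x_i)=\bigcup_{j=0}^{M_i}I_{i,j}$ with $I_{i,j}=[a^{[i]}_{2j},a^{[i]}_{2j+1}]$ the maximal intervals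 of $F(x_i)$ in increasing order. Let $\zeta(F(x_i))=\{a^{[i]}_0,\dots,a^{[i]}_{2M_i+1}\}$. Let $APCT(F,x_i)$ be the set of all $p=\frac12(\min I_{j,k+1}+\max I_{j,k})$ with $|j-i|=1$, $0\le k<M_j$, $p\in F(x_i)$, $p\notin F(x_j)$ (approximated PCTs). Let $EP_R(F,x_i)$ be the set of $p\in F(x_i)$ for which there is $j<i$ with $p\in APCT(F,x_j)$ and $p\in F(x_q)$ for all $j<q<i$; let $EP_L(F,x_i)$ be the set of $p\in F(x_i)$ for which there is $j>i$ with $p\in APCT(F,x_j)$ and $p\in F(x_q)$ for all $i<q<j$. Put $T_i=\zeta(F(x_i))\cup APCT(F,x_i)\cup EP_R(F,x_i)\cup EP_L(F,x_i)$. A significant metric chain is a metric chain $(f_0,\dots,f_N)$ of $\{F(x_i)\}$ with $(f_i,f_{i+1})\in\Pi(T_i,T_{i+1})$ for $0\le i\le N-1$. **The algorithm.** For each significant metric chain $(f_0,\dots,f_N)$ compute the polynomial of degree at most $N$ with value $f_i$ at $x_i$, $0\le i\le N$. Let $\tilde u,\tilde\ell$ be those of these polynomials that interpolate $u$, respectively $\ell$, at all the $x_i$. For a hole $H_i$, let $x_n,\dots,x_m$ be the sample points in $[c_i,d_i]$; its left and right approximated PCTs are $\big(x_{n-1},\frac12(g_i(x_n)+h_i(x_n))\big)$ and $\big(x_{m+1},\frac12(g_i(x_m)+h_i(x_m))\big)$. Choose (arbitrarily, if there are several) a pair of significant metric chains whose polynomials both pass through these two approximated PCTs, one of them taking the values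 $g_i(x_q)$ and the other the values $h_i(x_q)$ at $x_q$, $n\le q\le m$. Let $\tilde g_i,\tilde h_i$ be the restrictions of these two polynomials to $[\tilde c_i,\tilde d_i]:=[x_{n-1},x_{m+1}]$. Then $\tilde F_N(x)$ is defined by the representation $( * )$ with $\ell,u,g_i,h_i,[c_i,d_i]$ replaced by $\tilde\ell,\tilde u,\tilde g_i,\tilde h_i,[\tilde c_i,\tilde d_i]$. (All is understood for $N$ large enough that each hole contains sample points.) *)

theory Defs
  imports "HOL-Analysis.Analysis" "HOL-Computational_Algebra.Polynomial"
begin

section \<open>Set-valued functions\<close>

definition hausdorff_dist :: "real set \<Rightarrow> real set \<Rightarrow> real" where
  "hausdorff_dist A B = max (SUP x\<in>A. infdist x B) (SUP y\<in>B. infdist y A)"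

definition Kstar :: "real set set" where
  "Kstar = {A. A \<noteq> {} \<and> (\<exists>\<I>. finite \<I> \<and> (\<forall>I\<in>\<I>. \<exists>p q. p \<le> q \<and> I = {p..q}) \<and> A = \<Union>\<I>)}"

definition svf :: "real \<Rightarrow> real \<Rightarrow> (real \<Rightarrow> real set) \<Rightarrow> bool" where
  "svf a b F \<longleftrightarrow> (\<forall>x\<in>{a..b}. F x \<in> Kstar)"

definition svf_graph :: "real \<Rightarrow> real \<Rightarrow> (real \<Rightarrow> real set) \<Rightarrow> (real \<times> real) set" where
  "svf_graph a b F = {(x, y). x \<in> {a..b} \<and> y \<in> F x}"

definition svf_Lip :: "real \<Rightarrow> real \<Rightarrow> real \<Rightarrow> (real \<Rightarrow> real set) set" where
  "svf_Lip a b L =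
     {F. svf a b F \<and> (\<forall>x\<in>{a..b}. \<forall>y\<in>{a..b}. hausdorff_dist (F x) (F y) \<le> L * \<bar>x - y\<bar>)}"

text \<open>The values of an SVF are compact and non-empty, so that these are its maximum and minimum.\<close>

definition upper_bd :: "(real \<Rightarrow> real set) \<Rightarrow> real \<Rightarrow> real" where
  "upper_bd F x = Sup (F x)"

definition lower_bd :: "(real \<Rightarrow> real set) \<Rightarrow> real \<Rightarrow> real" where
  "lower_bd F x = Inf (F x)"


section \<open>Holes and the class of SVFs with finitely many of them\<close>

definition hole_region :: "real \<Rightarrow> real \<Rightarrow> (real \<Rightarrow> real) \<Rightarrow> (real \<Rightarrow> real) \<Rightarrow> (real \<times> real) set" where
  "hole_region c d g h = {(x, y). x \<in> {c<..<d} \<and> g x < y \<and> y < h x}"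

definition is_hole :: "real \<Rightarrow> real \<Rightarrow> (real \<Rightarrow> real set) \<Rightarrow>
    real \<Rightarrow> real \<Rightarrow> (real \<Rightarrow> real) \<Rightarrow> (real \<Rightarrow> real) \<Rightarrow> bool" where
  "is_hole a b F c d g h \<longleftrightarrow>
     c < d \<and> {c..d} \<subseteq> {a..b} \<and> g c = h c \<and> g d = h d \<and>
     (\<forall>x\<in>{c..d}. g x \<in> F x \<and> h x \<in> F x) \<and>
     \<not> hole_region c d g h \<subseteq> svf_graph a b F"

definition hole_curve :: "real \<Rightarrow> real \<Rightarrow> (real \<Rightarrow> real) \<Rightarrow> (real \<Rightarrow> real) \<Rightarrow> (real \<times> real) set" where
  "hole_curve c d g h = {(x, y). x \<in> {c..d} \<and> (y = g x \<or> y = h x)}"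

text \<open>
  The family \<open>(c i, d i, g i, h i)\<close>, \<open>i < M\<close>, describes the holes of \<open>F\<close>, and these satisfy
  the conditions that define the class of SVFs with \<open>M\<close> holes.  The first conjunct
  says that these are all the holes: what the graph of \<open>F\<close> leaves out of the area between the
  lower and the upper boundary of \<open>F\<close> is exactly the union of the \<open>M\<close> hole regions.
\<close>

definition holes_of :: "real \<Rightarrow> real \<Rightarrow> (real \<Rightarrow> real set) \<Rightarrow> nat \<Rightarrow> (nat \<Rightarrow> real) \<Rightarrow> (nat \<Rightarrow> real) \<Rightarrow>
    (nat \<Rightarrow> real \<Rightarrow> real) \<Rightarrow> (nat \<Rightarrow> real \<Rightarrow> real) \<Rightarrow> bool" where
  "holes_of a b F M c d g h \<longleftrightarrow>
     {(x, y). x \<in> {a..b} \<and> lower_bd F x \<le> y \<and> y \<le> upper_bd F x} - svf_graph a b F =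
       (\<Union>i<M. hole_region (c i) (d i) (g i) (h i)) \<and>
     (\<forall>i<M. is_hole a b F (c i) (d i) (g i) (h i)) \<and>
     (\<forall>i<M. \<forall>j<M. i \<noteq> j \<longrightarrow>
        closure (hole_region (c i) (d i) (g i) (h i)) \<inter>
        closure (hole_region (c j) (d j) (g j) (h j)) = {}) \<and>
     (\<forall>i<M. {c i..d i} \<subseteq> {a<..<b} \<and>
        (\<forall>x\<in>{c i..d i}. g i x \<le> h i x) \<and>
        (\<exists>\<gamma>. path \<gamma> \<and> pathfinish \<gamma> = pathstart \<gamma> \<and>
             path_image \<gamma> = hole_curve (c i) (d i) (g i) (h i)) \<and>
        inside (hole_curve (c i) (d i) (g i) (h i)) = hole_region (c i) (d i) (g i) (h i) \<and>
        (\<forall>x\<in>{c i<..<d i}. card {y. (x, y) \<in> hole_curve (c i) (d i) (g i) (h i)} = 2)) \<and>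
     (\<forall>i<M. \<forall>x\<in>{a..b}.
        (x, upper_bd F x) \<notin> hole_curve (c i) (d i) (g i) (h i) \<and>
        (x, lower_bd F x) \<notin> hole_curve (c i) (d i) (g i) (h i)) \<and>
     convex (F a) \<and> convex (F b)"

definition svf_class :: "real \<Rightarrow> real \<Rightarrow> nat \<Rightarrow> (real \<Rightarrow> real set) set" where
  "svf_class a b M = {F. svf a b F \<and> (\<exists>c d g h. holes_of a b F M c d g h)}"


section \<open>The representation by boundary functions\<close>

text \<open>
  Here \<open>closed_segment p q\<close> is the compact interval with end points \<open>p\<close> and \<open>q\<close>; it is
  \<open>{p..q}\<close> if \<open>p \<le> q\<close>, as is the case for the boundary functions of an SVF.  Polynomials
  that approximate boundary functions may cross where these meet (or, in the case of the lower
  and the upper boundary, coincide), and \<open>closed_segment\<close> then still is a non-empty compact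
  interval, so that the values of the representation always belong to \<open>Kstar\<close>.
\<close>

definition boundary_rep :: "(real \<Rightarrow> real) \<Rightarrow> (real \<Rightarrow> real) \<Rightarrow> nat \<Rightarrow> (nat \<Rightarrow> real) \<Rightarrow> (nat \<Rightarrow> real) \<Rightarrow>
    (nat \<Rightarrow> real \<Rightarrow> real) \<Rightarrow> (nat \<Rightarrow> real \<Rightarrow> real) \<Rightarrow> real \<Rightarrow> real set" where
  "boundary_rep l u M c d g h x =
     (let is = sort_key (\<lambda>i. g i x) (sorted_list_of_set {i. i < M \<and> x \<in> {c i..d i}});
          J = length is
      in if J = 0 then closed_segment (l x) (u x)
         else closed_segment (l x) (g (is ! 0) x)
              \<union> (\<Union>j<J - 1. closed_segment (h (is ! j) x) (g (is ! Suc j) x))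
              \<union> closed_segment (h (is ! (J - 1)) x) (u x))"


section \<open>Chebyshev points\<close>

fun chebyshev_poly :: "nat \<Rightarrow> real poly" where
  "chebyshev_poly 0 = 1"
| "chebyshev_poly (Suc 0) = [:0, 1:]"
| "chebyshev_poly (Suc (Suc n)) = [:0, 2:] * chebyshev_poly (Suc n) - chebyshev_poly n"

definition chebyshev_point :: "real \<Rightarrow> real \<Rightarrow> nat \<Rightarrow> nat \<Rightarrow> real" where
  "chebyshev_point a b N i =
     sorted_list_of_set
       ((\<lambda>t. (a + b) / 2 + (b - a) / 2 * t) ` {t. poly (chebyshev_poly (N + 1)) t = 0}) ! i"


section \<open>Metric chains\<close>

definition metric_proj :: "real set \<Rightarrow> real \<Rightarrow> real set" where
  "metric_proj V w = {v \<in> V. \<bar>v - w\<bar> = infdist w V}"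

definition metric_pairs :: "real set \<Rightarrow> real set \<Rightarrow> (real \<times> real) set" where
  "metric_pairs V W = {(v, w). v \<in> V \<and> w \<in> W \<and> (v \<in> metric_proj V w \<or> w \<in> metric_proj W v)}"

text \<open>
  In the following, \<open>S i\<close> for \<open>i \<le> N\<close> is the \<open>i\<close>-th sample of an SVF, and only the
  entries \<open>f i\<close> with \<open>i \<le> N\<close> of a chain \<open>f\<close> are relevant.
\<close>

definition metric_chain :: "nat \<Rightarrow> (nat \<Rightarrow> real set) \<Rightarrow> (nat \<Rightarrow> real) \<Rightarrow> bool" where
  "metric_chain N S f \<longleftrightarrow>
     (\<forall>i\<le>N. f i \<in> S i) \<and> (\<forall>i<N. (f i, f (i + 1)) \<in> metric_pairs (S i) (S (i + 1)))"

text \<open>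
  The maximal intervals of a set in \<open>Kstar\<close> are its connected components; \<open>ival_min A k\<close> and
  \<open>ival_max A k\<close> are the end points of the \<open>k\<close>-th one in increasing order, counted from 0.
\<close>

definition ival_min :: "real set \<Rightarrow> nat \<Rightarrow> real" where
  "ival_min A k = sorted_list_of_set (Inf ` components A) ! k"

definition ival_max :: "real set \<Rightarrow> nat \<Rightarrow> real" where
  "ival_max A k = sorted_list_of_set (Sup ` components A) ! k"

definition end_points :: "real set \<Rightarrow> real set" where
  "end_points A = Inf ` components A \<union> Sup ` components A"

definition APCT :: "nat \<Rightarrow> (nat \<Rightarrow> real set) \<Rightarrow> nat \<Rightarrow> real set" where
  "APCT N S i =
     {p. \<exists>j\<le>N. \<exists>k. (j = i + 1 \<or> i = j + 1) \<and> k + 1 < card (components (S j)) \<and>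
        p = (ival_min (S j) (k + 1) + ival_max (S j) k) / 2 \<and> p \<in> S i \<and> p \<notin> S j}"

definition EP_R :: "nat \<Rightarrow> (nat \<Rightarrow> real set) \<Rightarrow> nat \<Rightarrow> real set" where
  "EP_R N S i = {p \<in> S i. \<exists>j<i. p \<in> APCT N S j \<and> (\<forall>q. j < q \<and> q < i \<longrightarrow> p \<in> S q)}"

definition EP_L :: "nat \<Rightarrow> (nat \<Rightarrow> real set) \<Rightarrow> nat \<Rightarrow> real set" where
  "EP_L N S i =
     {p \<in> S i. \<exists>j. i < j \<and> j \<le> N \<and> p \<in> APCT N S j \<and> (\<forall>q. i < q \<and> q < j \<longrightarrow> p \<in> S q)}"

definition significant_points :: "nat \<Rightarrow> (nat \<Rightarrow> real set) \<Rightarrow> nat \<Rightarrow> real set" where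
  "significant_points N S i = end_points (S i) \<union> APCT N S i \<union> EP_R N S i \<union> EP_L N S i"

definition significant_metric_chain :: "nat \<Rightarrow> (nat \<Rightarrow> real set) \<Rightarrow> (nat \<Rightarrow> real) \<Rightarrow> bool" where
  "significant_metric_chain N S f \<longleftrightarrow>
     metric_chain N S f \<and>
     (\<forall>i<N. (f i, f (i + 1)) \<in> metric_pairs (significant_points N S i) (significant_points N S (i + 1)))"


section \<open>The approximated metric polynomial interpolant\<close>

text \<open>The polynomials that interpolate significant metric chains at the nodes \<open>x 0, \<dots>, x N\<close>.\<close>

definition chain_polys :: "nat \<Rightarrow> (nat \<Rightarrow> real) \<Rightarrow> (nat \<Rightarrow> real set) \<Rightarrow> real poly set" where
  "chain_polys N x S =
     {p. \<exists>f. significant_metric_chain N S f \<and> degree p \<le> N \<and> (\<forall>i\<le>N. poly p (x i) = f i)}"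

text \<open>
  \<open>pg\<close> and \<open>ph\<close> are a possible choice of polynomials for the hole \<open>(c, d, g, h)\<close>, where \<open>n\<close> and
  \<open>m\<close> are the indices of the first and the last node in \<open>{c..d}\<close>.
\<close>

definition hole_polys :: "nat \<Rightarrow> (nat \<Rightarrow> real) \<Rightarrow> (nat \<Rightarrow> real set) \<Rightarrow>
    (real \<Rightarrow> real) \<Rightarrow> (real \<Rightarrow> real) \<Rightarrow> nat \<Rightarrow> nat \<Rightarrow> real poly \<Rightarrow> real poly \<Rightarrow> bool" where
  "hole_polys N x S g h n m pg ph \<longleftrightarrow>
     pg \<in> chain_polys N x S \<and> ph \<in> chain_polys N x S \<and>
     (\<forall>p\<in>{pg, ph}. poly p (x (n - 1)) = (g (x n) + h (x n)) / 2 \<and>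
                   poly p (x (m + 1)) = (g (x m) + h (x m)) / 2) \<and>
     (\<forall>q\<in>{n..m}. poly pg (x q) = g (x q) \<and> poly ph (x q) = h (x q))"

text \<open>
  \<open>G\<close> is a possible output of the algorithm for the samples of \<open>F\<close> at the \<open>N + 1\<close> Chebyshev
  points of \<open>{a..b}\<close>.  This is a relation, as the algorithm involves arbitrary choices.
\<close>

definition approx_metric_interpolant :: "real \<Rightarrow> real \<Rightarrow> (real \<Rightarrow> real set) \<Rightarrow> nat \<Rightarrow>
    (nat \<Rightarrow> real) \<Rightarrow> (nat \<Rightarrow> real) \<Rightarrow> (nat \<Rightarrow> real \<Rightarrow> real) \<Rightarrow> (nat \<Rightarrow> real \<Rightarrow> real) \<Rightarrow>
    nat \<Rightarrow> (real \<Rightarrow> real set) \<Rightarrow> bool" where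
  "approx_metric_interpolant a b F M c d g h N G \<longleftrightarrow>
     (let x = chebyshev_point a b N;
          S = (\<lambda>i. F (x i));
          nodes = (\<lambda>i. {q. q \<le> N \<and> x q \<in> {c i..d i}});
          n = (\<lambda>i. Min (nodes i));
          m = (\<lambda>i. Max (nodes i))
      in (\<forall>i<M. nodes i \<noteq> {} \<and> 0 < n i \<and> m i < N) \<and>
         (\<exists>pl pu pg ph.
            pl \<in> chain_polys N x S \<and> (\<forall>i\<le>N. poly pl (x i) = lower_bd F (x i)) \<and>
            pu \<in> chain_polys N x S \<and> (\<forall>i\<le>N. poly pu (x i) = upper_bd F (x i)) \<and>
            (\<forall>i<M. hole_polys N x S (g i) (h i) (n i) (m i) (pg i) (ph i)) \<and>
            (\<forall>t\<in>{a..b}. G t =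
               boundary_rep (poly pl) (poly pu) M (\<lambda>i. x (n i - 1)) (\<lambda>i. x (m i + 1))
                 (\<lambda>i. poly (pg i)) (\<lambda>i. poly (ph i)) t)))"

end

theory Submission
  imports Defs
begin

text \<open>
  Consecutive points of a metric chain differ by at most the Hausdorff distance of the samples, so
  every chain polynomial interpolates \<open>L\<close>-Lipschitz data, which extend to an \<open>L\<close>-Lipschitz function.
  Interpolation of a Lipschitz function at Chebyshev points has error \<open>O(log N / N)\<close>: the
  interpolation error is \<open>T(x) / n\<close> times an alternating sum whose terms have total variation
  \<open>O(log n)\<close>, so that neither Jackson's theorem nor the Lebesgue constant is needed.  The boundary
  functions of \<open>F\<close> and of its holes are \<open>L\<close>-Lipschitz as well; hence at every \<open>t\<close> the boundaries and the
  gaps of the interpolant are \<open>O(log N / N)\<close>-close to those of \<open>F\<close>, except for additional gaps near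
  the points of change of topology, which have length \<open>O(log N / N)\<close>.  Since distinct holes and the
  outer boundaries are uniformly separated, the approximate gaps occur in the right order for large \<open>N\<close>.
\<close>

section \<open>Interpolation at Chebyshev points\<close>

text \<open>The definition of a hole asks for no continuity of \<open>g\<close> and
  \<open>h\<close>, yet the estimate needs a modulus for them that survives where the hole closes.
  Two facts supply it: the hole is open, being the inside of a curve, and the curve is a closed set.
  Openness gives the estimate near interior points; closedness carries it to the ends, where
  \<open>g\<close> and \<open>h\<close> meet.

  In the interpolation error the weights sin(theta_k) compensate for the crowding of the nodes near
  the ends of the interval. Up to a term of order L / n, consecutive summands then differ by a
  multiple of L / |k - m|, where \<open>m\<close> is the index of the angle nearest to that of
  \<open>x\<close>; the logarithm is a harmonic sum.

  Chains, polynomials and arbitrary choices vary with \<open>N\<close>, so every error bound may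
  depend only on \<open>L\<close> and \<open>b - a\<close>. The separation of the holes merely
  decides how large \<open>N\<close> has to be.\<close>

definition cheb_angle :: "nat \<Rightarrow> nat \<Rightarrow> real" where
  "cheb_angle n k = real (2 * k + 1) * pi / (2 * real n)"

lemma cheb_angle_bounds:
  assumes "k < n"
  shows "0 < cheb_angle n k" "cheb_angle n k < pi"
proof -
  have "real (2 * k + 1) * pi < 2 * real n * pi"
    using assms by (intro mult_strict_right_mono) auto
  then show "0 < cheb_angle n k" "cheb_angle n k < pi"
    using assms by (simp_all add: cheb_angle_def field_simps add_pos_nonneg)
qed

lemma cheb_angle_less: "0 < n \<Longrightarrow> j < k \<Longrightarrow> cheb_angle n j < cheb_angle n k"
  by (auto simp: cheb_angle_def field_simps)

lemma cheb_angle_Suc: "\<bar>cheb_angle n k - cheb_angle n (Suc k)\<bar> = pi / real n"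
proof -
  have "cheb_angle n (Suc k) = cheb_angle n k + pi / real n"
    by (cases "n = 0") (auto simp: cheb_angle_def field_simps)
  then show ?thesis by simp
qed

lemma cos_cheb_angle_less:
  assumes "j < k" "k < n"
  shows "cos (cheb_angle n k) < cos (cheb_angle n j)"
  using assms cheb_angle_bounds[of j n] cheb_angle_bounds[of k n] cheb_angle_less[of n j k]
  by (intro cos_monotone_0_pi) auto

lemma inj_on_cos_cheb_angle: "inj_on (\<lambda>k. cos (cheb_angle n k)) {..<n}"
  by (rule linorder_inj_onI) (use cos_cheb_angle_less in fastforce)+

lemma chebyshev_poly_cos: "poly (chebyshev_poly n) (cos t) = cos (real n * t)"
proof (induction n rule: chebyshev_poly.induct)
  case (3 n)
  have "cos (real (Suc (Suc n)) * t) + cos (real n * t) = 2 * cos t * cos (real (Suc n) * t)"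
    using cos_plus_cos[of "real (Suc (Suc n)) * t" "real n * t"]
    by (simp add: algebra_simps add_divide_distrib)
  then show ?case
    using 3 by simp
qed auto

lemma degree_chebyshev_poly: "degree (chebyshev_poly n) \<le> n"
proof (induction n rule: chebyshev_poly.induct)
  case (3 n)
  have "degree ([:0, 2:] * chebyshev_poly (Suc n)) \<le> 1 + Suc n"
    using degree_mult_le[of "[:0, 2:]" "chebyshev_poly (Suc n)"] 3 by simp
  then show ?case
    using 3 by (auto intro!: degree_diff_le)
qed auto

lemma chebyshev_poly_nonzero: "chebyshev_poly n \<noteq> 0"
  using chebyshev_poly_cos[of n 0] by auto

lemma cos_cheb_angle_mult: "0 < n \<Longrightarrow> cos (real n * cheb_angle n k) = 0"
  and sin_cheb_angle_mult: "0 < n \<Longrightarrow> sin (real n * cheb_angle n k) = (-1) ^ k"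
proof -
  assume "0 < n"
  then have "real n * cheb_angle n k = real k * pi + pi / 2"
    by (simp add: cheb_angle_def field_simps)
  then show "cos (real n * cheb_angle n k) = 0" "sin (real n * cheb_angle n k) = (-1) ^ k"
    by (simp_all add: cos_add sin_add)
qed

text \<open>The \<open>n\<close> cosines are distinct, and degree at most \<open>n\<close> leaves no
  room for further roots.\<close>

lemma chebyshev_poly_roots:
  assumes "0 < n"
  shows "{t. poly (chebyshev_poly n) t = 0} = (\<lambda>k. cos (cheb_angle n k)) ` {..<n}"
proof (rule card_seteq[symmetric])
  show "finite {t. poly (chebyshev_poly n) t = 0}"
    by (rule poly_roots_finite[OF chebyshev_poly_nonzero])
  show "(\<lambda>k. cos (cheb_angle n k)) ` {..<n} \<subseteq> {t. poly (chebyshev_poly n) t = 0}"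
    using assms by (auto simp: chebyshev_poly_cos cos_cheb_angle_mult)
  show "card {t. poly (chebyshev_poly n) t = 0} \<le> card ((\<lambda>k. cos (cheb_angle n k)) ` {..<n})"
    using card_poly_roots_bound[OF chebyshev_poly_nonzero[of n]] degree_chebyshev_poly[of n]
    by (simp add: card_image inj_on_cos_cheb_angle)
qed

text \<open>Cosine reverses the order of the angles, hence the index \<open>N - i\<close>. A
  strictly increasing list is what \<open>sorted_list_of_set\<close> returns for its set of
  entries.\<close>

lemma chebyshev_point_eq:
  assumes "a < b" "i \<le> N"
  shows "chebyshev_point a b N i = (a + b) / 2 + (b - a) / 2 * cos (cheb_angle (N + 1) (N - i))"
proof -
  define y where "y i = (a + b) / 2 + (b - a) / 2 * cos (cheb_angle (N + 1) (N - i))" for i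
  let ?xs = "map y [0..<Suc N]"
  have less: "y j < y k" if "j < k" "k < Suc N" for j k
    using assms that unfolding y_def
    by (auto intro!: cos_cheb_angle_less mult_strict_left_mono)
  have "sorted_wrt (<) ?xs"
    using less by (auto simp: sorted_wrt_iff_nth_less simp del: upt_Suc)
  then have "sorted_list_of_set (set ?xs) = ?xs"
    unfolding strict_sorted_iff by (intro sorted_list_of_set.idem_if_sorted_distinct) auto
  moreover have "set ?xs = (\<lambda>t. (a + b) / 2 + (b - a) / 2 * t) ` {t. poly (chebyshev_poly (N + 1)) t = 0}"
  proof -
    have eq: "{..<N + 1} = (\<lambda>i. N - i) ` {0..<Suc N}"
    proof (intro set_eqI iffI)
      fix k assume "k \<in> {..<N + 1}"
      then show "k \<in> (\<lambda>i. N - i) ` {0..<Suc N}"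
        by (intro image_eqI[of _ _ "N - k"]) auto
    qed auto
    show ?thesis
      unfolding chebyshev_poly_roots[OF zero_less_Suc[of N, unfolded Suc_eq_plus1]] eq set_map set_upt image_image
      by (rule image_cong[OF refl]) (simp only: y_def)
  qed
  ultimately show ?thesis
    using assms unfolding chebyshev_point_def
    by (metis (no_types, lifting) add_0 diff_zero le_imp_less_Suc nth_map_upt y_def)
qed

section \<open>Lagrange's formula at the roots of \<open>chebyshev_poly n\<close>\<close>

lemma chebyshev_pderiv:
  assumes "0 < n" "k < n"
  shows "poly (pderiv (chebyshev_poly n)) (cos (cheb_angle n k)) * sin (cheb_angle n k)
           = real n * (-1) ^ k"
proof -
  let ?t = "cheb_angle n k"
  have D1: "((\<lambda>t. poly (chebyshev_poly n) (cos t)) has_real_derivative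
          poly (pderiv (chebyshev_poly n)) (cos ?t) * (- sin ?t)) (at ?t)"
    by (rule DERIV_chain'[OF DERIV_cos, of "poly (chebyshev_poly n)", simplified mult.commute])
       (rule poly_DERIV)
  have D2: "((\<lambda>t. cos (real n * t)) has_real_derivative - sin (real n * ?t) * real n) (at ?t)"
    by (auto intro!: derivative_eq_intros)
  have "poly (pderiv (chebyshev_poly n)) (cos ?t) * (- sin ?t) = - sin (real n * ?t) * real n"
    by (rule DERIV_unique[OF D1[unfolded chebyshev_poly_cos] D2])
  then show ?thesis
    using assms by (simp add: sin_cheb_angle_mult)
qed

text \<open>With \<open>Q k\<close> = T / (x - s k), the Lagrange basis polynomial is
  \<open>Q k\<close> divided by its value at \<open>s k\<close>. That value is T'(s k), which
  \<open>chebyshev_pderiv\<close> evaluates to n (-1)^k / sin(theta_k): the origin of the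
  alternating signs and of the sine weights.\<close>

lemma cheb_interpolation_formula:
  assumes n: "0 < n" and deg: "degree p < n" and x: "\<And>k. k < n \<Longrightarrow> x \<noteq> cos (cheb_angle n k)"
  shows "poly p x = poly (chebyshev_poly n) x / real n *
    (\<Sum>k<n. (-1) ^ k * (sin (cheb_angle n k) * poly p (cos (cheb_angle n k))
        / (x - cos (cheb_angle n k))))"
proof -
  define T where "T = chebyshev_poly n"
  define s where "s k = cos (cheb_angle n k)" for k
  have root: "poly T (s k) = 0" if "k < n" for k
    using n that by (simp add: T_def s_def chebyshev_poly_cos cos_cheb_angle_mult)
  then have "\<exists>Q. T = [:- s k, 1:] * Q" if "k < n" for k
    using that by (simp add: poly_eq_0_iff_dvd dvd_def)
  then obtain Q where Q: "\<And>k. k < n \<Longrightarrow> T = [:- s k, 1:] * Q k"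
    by metis
  have degQ: "degree (Q k) < n" if "k < n" for k
  proof -
    have "Q k \<noteq> 0"
      using Q[OF that] chebyshev_poly_nonzero[of n] by (auto simp: T_def)
    then have "degree T = 1 + degree (Q k)"
      by (subst Q[OF that], subst degree_mult_eq) auto
    then show ?thesis
      using degree_chebyshev_poly[of n] by (simp add: T_def)
  qed
  have Q0: "poly (Q k) (s j) = 0" if "k < n" "j < n" "j \<noteq> k" for j k
  proof -
    have "s j \<noteq> s k"
      using inj_onD[OF inj_on_cos_cheb_angle[of n], of j k] that by (auto simp: s_def)
    moreover have "(s j - s k) * poly (Q k) (s j) = 0"
      using root[OF that(2)] unfolding Q[OF that(1)] by auto
    ultimately show ?thesis by auto
  qed
  have Q1: "poly (Q k) (s k) * sin (cheb_angle n k) = real n * (-1) ^ k" if "k < n" for k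
  proof -
    have "poly (pderiv T) (s k) = poly (Q k) (s k)"
      by (subst Q[OF that], subst pderiv_mult) (simp add: pderiv_pCons)
    then show ?thesis
      using chebyshev_pderiv[OF n that] by (simp add: T_def s_def)
  qed
  define R where "R = (\<Sum>k<n. smult ((-1) ^ k * sin (cheb_angle n k) * poly p (s k) / real n) (Q k))"
  have "p = R"
  proof (rule poly_eqI_degree[where A = "s ` {..<n}"])
    fix y assume "y \<in> s ` {..<n}"
    then obtain j where j: "j < n" "y = s j" by auto
    have "poly R y = (\<Sum>k<n. (-1) ^ k * sin (cheb_angle n k) * poly p (s k) / real n * poly (Q k) (s j))"
      by (simp add: R_def poly_sum j)
    also have "\<dots> = (\<Sum>k<n. if k = j then poly p (s j) else 0)"
    proof (intro sum.cong refl)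
      fix k assume k: "k \<in> {..<n}"
      show "(-1) ^ k * sin (cheb_angle n k) * poly p (s k) / real n * poly (Q k) (s j)
        = (if k = j then poly p (s j) else 0)"
      proof (cases "k = j")
        case True
        have "(-1) ^ j * sin (cheb_angle n j) * poly p (s j) / real n * poly (Q j) (s j)
          = (-1) ^ j * poly p (s j) / real n * (poly (Q j) (s j) * sin (cheb_angle n j))"
          by simp
        also have "\<dots> = poly p (s j)"
          using n by (simp only: Q1[OF j(1)]) (simp flip: power_add mult_2)
        finally show ?thesis using True by simp
      qed (use k j Q0 in auto)
    qed
    finally show "poly p y = poly R y" using j by simp
  next
    have "card (s ` {..<n}) = n"
      using inj_on_cos_cheb_angle[of n] by (simp add: card_image s_def)
    moreover have "degree R < n"
      unfolding R_def using degQ n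
      by (intro degree_sum_less) (auto intro: le_less_trans[OF degree_smult_le])
    ultimately show "degree p < card (s ` {..<n})" "degree R < card (s ` {..<n})"
      using deg by auto
  qed
  have "poly (Q k) x = poly T x / (x - s k)" if "k < n" for k
    using x[OF that] by (subst Q[OF that]) (auto simp: s_def field_simps)
  then show ?thesis
    by (subst \<open>p = R\<close>)
       (auto simp: R_def poly_sum sum_distrib_left T_def s_def intro!: sum.cong)
qed

section \<open>Alternating and harmonic sums\<close>

lemma alternating_sum_by_parts:
  fixes f :: "nat \<Rightarrow> real"
  shows "2 * (\<Sum>k\<le>r. (-1) ^ k * f k) =
    f 0 + (-1) ^ r * f r + (\<Sum>k<r. (-1) ^ k * (f k - f (Suc k)))"
  by (induction r) (auto simp: algebra_simps)

text \<open>Pairing neighbours leaves two end terms and the total variation, whereas absolute values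
  term by term would give \<open>n * B\<close>.\<close>

lemma alternating_sum_bound:
  fixes f :: "nat \<Rightarrow> real"
  assumes "0 < n" and B: "\<And>k. k < n \<Longrightarrow> \<bar>f k\<bar> \<le> B"
  shows "\<bar>\<Sum>k<n. (-1) ^ k * f k\<bar> \<le> B + (\<Sum>k<n - 1. \<bar>f k - f (Suc k)\<bar>)"
proof -
  obtain r where r: "n = Suc r" using assms(1) by (cases n) auto
  have "\<bar>\<Sum>k<r. (-1) ^ k * (f k - f (Suc k))\<bar> \<le> (\<Sum>k<r. \<bar>f k - f (Suc k)\<bar>)"
    by (rule order_trans[OF sum_abs]) (simp add: abs_mult)
  moreover have "\<bar>(-1) ^ r * f r\<bar> \<le> B" "\<bar>f 0\<bar> \<le> B"
    using B[of r] B[of 0] r by (auto simp: abs_mult)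
  moreover have "0 \<le> (\<Sum>k<r. \<bar>f k - f (Suc k)\<bar>)"
    by (simp add: sum_nonneg)
  ultimately show ?thesis
    using alternating_sum_by_parts[of f r] unfolding r lessThan_Suc_atMost by simp
qed

text \<open>The term \<open>j = m\<close> is 1 / 0 = 0 in HOL and drops out; the indices below and
  above \<open>m\<close> contribute one harmonic sum each.\<close>

lemma sum_inverse_dist_le_harm:
  "(\<Sum>j<n. 1 / \<bar>real j - real m\<bar>) \<le> 2 * harm n" if "m \<le> n"
proof -
  have "(\<Sum>j<n. 1 / \<bar>real j - real m\<bar>) =
      (\<Sum>j<m. 1 / \<bar>real j - real m\<bar>) + (\<Sum>j=m..<n. 1 / \<bar>real j - real m\<bar>)"
    using that by (simp add: sum.atLeastLessThan_concat[of 0 m n, symmetric] lessThan_atLeast0)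
  moreover have "(\<Sum>j<m. 1 / \<bar>real j - real m\<bar>) = harm m"
    unfolding harm_altdef
    by (subst sum.nat_diff_reindex[symmetric]) (auto intro!: sum.cong simp: of_nat_diff inverse_eq_divide)
  moreover have "(\<Sum>j=m..<n. 1 / \<bar>real j - real m\<bar>) = harm (n - m - 1)"
  proof (cases "n = m")
    case False
    with that have "m < n" by simp
    then obtain r where r: "n = m + Suc r"
      using less_imp_Suc_add by force
    have "(\<Sum>j=m..<n. 1 / \<bar>real j - real m\<bar>) = (\<Sum>i<Suc r. 1 / real i)"
      by (rule sum.reindex_bij_witness[of _ "\<lambda>i. i + m" "\<lambda>j. j - m"]) (auto simp: r)
    also have "\<dots> = (\<Sum>i<r. inverse (real (Suc i)))"
      by (subst sum.lessThan_Suc_shift) (simp add: inverse_eq_divide)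
    finally show ?thesis
      by (simp add: harm_altdef r)
  qed (simp add: harm_def)
  moreover have "harm m \<le> (harm n :: real)" "harm (n - m - 1) \<le> (harm n :: real)"
    using that by (auto intro!: harm_mono)
  ultimately show ?thesis by simp
qed

lemma harm_le_ln: "0 < n \<Longrightarrow> harm n \<le> 1 + ln (real n)"
  using decseqD[OF decseq_harm_diff_ln, of 0 "n - 1"] by (simp add: harm_expand)

section \<open>Trigonometric inequalities\<close>

lemma third_le_sin:
  fixes u :: real
  assumes "0 \<le> u" "u \<le> pi / 2"
  shows "u / 3 \<le> sin u"
proof -
  have "\<bar>sin u - u\<bar> \<le> \<bar>u\<bar> ^ 3 / 6"
    using Maclaurin_sin_bound[of u 3] by (simp add: numeral_3_eq_3 sin_coeff_def fact_numeral field_simps)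
  \<comment> \<open>As pi / 2 < 2, the square of \<open>u\<close> is at most 4, so the Taylor
    remainder \<open>u ^ 3 / 6\<close> is at most two thirds of \<open>u\<close>.\<close>
  moreover have "u ^ 3 \<le> u * 4"
  proof -
    have "u \<le> 2" using assms pi_half_less_two by linarith
    then have "u\<^sup>2 \<le> 2\<^sup>2" using assms by (intro power_mono) auto
    then show ?thesis using mult_left_mono[of "u\<^sup>2" 4 u] assms by (simp add: power3_eq_cube power2_eq_square)
  qed
  ultimately show ?thesis using assms by (simp add: abs_if split: if_splits)
qed

text \<open>In cos t - cos w = 2 sin((t + w) / 2) sin((w - t) / 2), twice the first sine is at least
  sin t + sin w, and the second is at least |t - w| / 6 in absolute value. Thus the weight
  \<open>sin w\<close> pays for the flatness of cosine at 0 and pi.\<close>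

lemma sin_le_cos_diff:
  assumes "0 \<le> t" "t \<le> pi" "0 \<le> w" "w \<le> pi"
  shows "sin w * \<bar>t - w\<bar> \<le> 6 * \<bar>cos t - cos w\<bar>"
proof -
  have "\<bar>t - w\<bar> / 2 / 3 \<le> sin (\<bar>t - w\<bar> / 2)"
    using assms by (intro third_le_sin) auto
  also have "\<dots> = \<bar>sin ((w - t) / 2)\<bar>"
  proof -
    have "0 \<le> sin (\<bar>t - w\<bar> / 2)" using assms by (intro sin_ge_zero) auto
    moreover have "\<bar>t - w\<bar> / 2 = (w - t) / 2 \<or> \<bar>t - w\<bar> / 2 = - ((w - t) / 2)"
      by (auto simp: abs_if field_simps)
    then have "sin (\<bar>t - w\<bar> / 2) = sin ((w - t) / 2) \<or> sin (\<bar>t - w\<bar> / 2) = - sin ((w - t) / 2)"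
      by (metis sin_minus)
    ultimately show ?thesis by linarith
  qed
  finally have 1: "\<bar>t - w\<bar> \<le> 6 * \<bar>sin ((w - t) / 2)\<bar>" by simp
  have 2: "sin w \<le> 2 * sin ((t + w) / 2)" "0 \<le> sin ((t + w) / 2)"
  proof -
    show pos: "0 \<le> sin ((t + w) / 2)" using assms by (intro sin_ge_zero) auto
    have "sin w \<le> sin t + sin w" using assms sin_ge_zero[of t] by simp
    also have "\<dots> \<le> 2 * sin ((t + w) / 2)"
      using mult_left_mono[OF cos_le_one, of "2 * sin ((t + w) / 2)" "(t - w) / 2"] pos
      by (simp add: sin_plus_sin)
    finally show "sin w \<le> 2 * sin ((t + w) / 2)" .
  qed
  have "sin w * \<bar>t - w\<bar> \<le> 2 * sin ((t + w) / 2) * (6 * \<bar>sin ((w - t) / 2)\<bar>)"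
    using 1 2 sin_ge_zero[of w] assms by (intro mult_mono) auto
  also have "\<dots> = 6 * \<bar>cos t - cos w\<bar>"
    using 2 by (simp add: cos_diff_cos abs_mult)
  finally show ?thesis .
qed

lemma abs_cos_diff_le: "\<bar>cos t - cos w\<bar> \<le> \<bar>t - w\<bar>" for t w :: real
proof -
  have "\<bar>sin ((t + w) / 2)\<bar> * \<bar>sin ((w - t) / 2)\<bar> \<le> 1 * \<bar>(w - t) / 2\<bar>"
    by (intro mult_mono abs_sin_x_le_abs_x) auto
  then show ?thesis by (simp add: cos_diff_cos abs_mult)
qed

lemma abs_sin_diff_le: "\<bar>sin t - sin w\<bar> \<le> \<bar>t - w\<bar>" for t w :: real
proof -
  have "\<bar>sin ((t - w) / 2)\<bar> * \<bar>cos ((t + w) / 2)\<bar> \<le> \<bar>(t - w) / 2\<bar> * 1"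
    by (intro mult_mono abs_sin_x_le_abs_x) auto
  then show ?thesis by (simp add: sin_diff_sin abs_mult)
qed

text \<open>Applied to \<open>p\<close> minus the constant \<open>f x\<close>, Lagrange's formula
  turns the error into an alternating sum of sine-weighted difference quotients of \<open>f\<close>
  at \<open>x\<close>. Each is at most \<open>L\<close>, and their variation is at most 4 L + 2 L +
  48 L (1 + ln n); the end terms add one more \<open>L\<close>, which makes 55.\<close>

lemma cheb_interpolation_error:
  fixes f :: "real \<Rightarrow> real"
  assumes n: "0 < n" and deg: "degree p < n"
    and p: "\<And>k. k < n \<Longrightarrow> poly p (cos (cheb_angle n k)) = f (cos (cheb_angle n k))"
    and Lip: "\<And>x y. x \<in> {-1..1} \<Longrightarrow> y \<in> {-1..1} \<Longrightarrow> \<bar>f x - f y\<bar> \<le> L * \<bar>x - y\<bar>"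
    and x: "x \<in> {-1..1}"
  shows "\<bar>poly p x - f x\<bar> \<le> L * (55 + 48 * ln (real n)) / real n"
proof -
  define s where "s k = cos (cheb_angle n k)" for k
  have s: "s k \<in> {-1..1}" for k by (simp add: s_def)
  have L: "0 \<le> L" using Lip[of 1 0] by simp
  have lnn: "0 \<le> ln (real n)" using n by simp
  show ?thesis
  proof (cases "\<exists>k<n. x = s k")
    case True
    then show ?thesis using p L lnn by (auto simp: s_def)
  next
    case False
    then have ne: "x \<noteq> s k" if "k < n" for k using that by auto
    define t where "t = arccos x"
    have t: "0 \<le> t" "t \<le> pi" "cos t = x"
      using x by (auto simp: t_def arccos_lbound arccos_ubound)
    define q where "q k = (f (s k) - f x) / (x - s k)" for k
    define \<phi> where "\<phi> k = sin (cheb_angle n k) * q k" for k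
    have sin_nn: "0 \<le> sin (cheb_angle n k)" if "k < n" for k
      using cheb_angle_bounds[OF that] by (intro sin_ge_zero) auto
    have q: "\<bar>q k\<bar> \<le> L" if "k < n" for k
      using Lip[OF s[of k] x] ne[OF that]
      by (simp add: q_def abs_divide divide_le_eq abs_minus_commute)
    have \<phi>: "\<bar>\<phi> k\<bar> \<le> L" if "k < n" for k
      using mult_mono[OF sin_le_one q[OF that], of "cheb_angle n k"] sin_nn[OF that]
      by (simp add: \<phi>_def abs_mult)
    \<comment> \<open>The angle \<open>t\<close> lies in the cell of length pi / n centred at
      \<open>cheb_angle n m\<close>, so index distance to \<open>m\<close> measures angular distance
      to \<open>t\<close>. For t = pi this gives m = n, one past the last node.\<close>
    define m where "m = nat \<lfloor>real n * t / pi\<rfloor>"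
    have m: "real m \<le> real n * t / pi" "real n * t / pi < real m + 1"
      using t unfolding m_def by (auto simp: of_nat_nat)
    have "real n * t / pi \<le> real n"
      using t mult_left_mono[of t pi "real n"] by (simp add: field_simps)
    then have mn: "m \<le> n" using m by linarith
    \<comment> \<open>At \<open>Suc k = m\<close> the last fraction is a division by 0, hence 0, and
      the trivial bound \<open>2 * L\<close> takes its place.\<close>
    have diff: "\<bar>\<phi> k - \<phi> (Suc k)\<bar> \<le>
        L * pi / real n + (if Suc k = m then 2 * L else 0) + 24 * L / \<bar>real (Suc k) - real m\<bar>"
      if k: "Suc k < n" for k
    proof (cases "Suc k = m")
      case True
      have "\<bar>\<phi> k - \<phi> (Suc k)\<bar> \<le> 2 * L"
        using \<phi>[of k] \<phi>[of "Suc k"] k by linarith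
      moreover have "0 \<le> L * pi / real n" using L by simp
      ultimately have "\<bar>\<phi> k - \<phi> (Suc k)\<bar> \<le> L * pi / real n + 2 * L" by linarith
      then show ?thesis using True by simp
    next
      case False
      let ?w = "cheb_angle n (Suc k)"
      have w: "0 \<le> ?w" "?w \<le> pi" using cheb_angle_bounds[OF k] by auto
      \<comment> \<open>The number n t / pi is within 1 / 2 of m + 1 / 2. A loss of 1 / 2 against an
        integer distance of at least 1 costs at most a factor 2.\<close>
      have far: "\<bar>real (Suc k) - real m\<bar> \<le> 2 * (real n / pi) * \<bar>t - ?w\<bar>"
      proof -
        have "real n / pi * (t - ?w) = real n * t / pi - (real (Suc k) + 1 / 2)"
          using n by (simp add: cheb_angle_def field_simps)
        moreover have "\<bar>real (Suc k) - real m\<bar> \<le> 2 * \<bar>v - (real (Suc k) + 1 / 2)\<bar>"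
          if "real m \<le> v" "v < real m + 1" for v
        proof -
          have "1 \<le> \<bar>real (Suc k) - real m\<bar>" using False by linarith
          then show ?thesis using that by (auto simp: abs_if split: if_splits)
        qed
        ultimately have "\<bar>real (Suc k) - real m\<bar> \<le> 2 * \<bar>real n / pi * (t - ?w)\<bar>"
          using m by metis
        then show ?thesis by (simp add: abs_mult)
      qed
      define D where "D = \<bar>real (Suc k) - real m\<bar>"
      have D: "0 < D" using False by (simp add: D_def)
      have step: "\<bar>s k - s (Suc k)\<bar> \<le> pi / real n"
        using abs_cos_diff_le[of "cheb_angle n k" "cheb_angle n (Suc k)"] cheb_angle_Suc[of n k]
        by (simp add: s_def abs_minus_commute)
      have ne': "x \<noteq> s k" "x \<noteq> s (Suc k)" using ne k by auto
      \<comment> \<open>Over this single denominator no product of two small distances to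
        \<open>x\<close> arises; both terms of the numerator are at most \<open>L\<close> times the
        node spacing.\<close>
      have "q k - q (Suc k) =
          ((f (s k) - f (s (Suc k))) + q k * (s k - s (Suc k))) / (x - s (Suc k))"
        using ne' by (simp add: q_def divide_simps) (simp add: algebra_simps)
      also have "\<bar>\<dots>\<bar> \<le> (2 * L * (pi / real n)) / \<bar>x - s (Suc k)\<bar>"
      proof -
        have "\<bar>f (s k) - f (s (Suc k))\<bar> \<le> L * (pi / real n)"
          using Lip[OF s s] step L by (meson mult_left_mono order_trans)
        moreover have "\<bar>q k * (s k - s (Suc k))\<bar> \<le> L * (pi / real n)"
          unfolding abs_mult using q[of k] step k L by (intro mult_mono) auto
        ultimately show ?thesis
          unfolding abs_divide by (intro divide_right_mono) linarith+
      qed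
      finally have 1: "\<bar>q k - q (Suc k)\<bar> \<le> 2 * L * (pi / real n) / \<bar>x - s (Suc k)\<bar>" .
      \<comment> \<open>The spacing pi / n over the distance to \<open>x\<close> alone is not
        controlled near the ends; the sine weight turns it into a reciprocal index distance.\<close>
      have "sin ?w / \<bar>x - s (Suc k)\<bar> \<le> 12 * (real n / pi) / D"
      proof -
        have "sin ?w * D \<le> sin ?w * (2 * (real n / pi) * \<bar>t - ?w\<bar>)"
          using far sin_nn[OF k] unfolding D_def by (intro mult_left_mono) auto
        also have "\<dots> \<le> 2 * (real n / pi) * (6 * \<bar>x - s (Suc k)\<bar>)"
          using mult_left_mono[OF sin_le_cos_diff[OF t(1,2) w], of "2 * (real n / pi)"] n
          by (simp add: t s_def mult_ac)
        finally show ?thesis using D ne' by (simp add: divide_simps mult_ac)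
      qed
      then have "sin ?w / \<bar>x - s (Suc k)\<bar> * (2 * L * (pi / real n))
          \<le> 12 * (real n / pi) / D * (2 * L * (pi / real n))"
        using L by (intro mult_right_mono) auto
      then have 2: "sin ?w * \<bar>q k - q (Suc k)\<bar> \<le> 24 * L / D"
        using mult_left_mono[OF 1 sin_nn[OF k]] n by (simp add: mult_ac)
      have 3: "\<bar>sin (cheb_angle n k) - sin ?w\<bar> * \<bar>q k\<bar> \<le> pi / real n * L"
        using abs_sin_diff_le[of "cheb_angle n k" ?w] cheb_angle_Suc[of n k] q[of k] k n
        by (intro mult_mono) auto
      have "\<phi> k - \<phi> (Suc k) = (sin (cheb_angle n k) - sin ?w) * q k + sin ?w * (q k - q (Suc k))"
        by (simp add: \<phi>_def algebra_simps)
      also have "\<bar>\<dots>\<bar> \<le> \<bar>sin (cheb_angle n k) - sin ?w\<bar> * \<bar>q k\<bar> + sin ?w * \<bar>q k - q (Suc k)\<bar>"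
        using sin_nn[OF k] by (intro order_trans[OF abs_triangle_ineq]) (simp add: abs_mult)
      also have "\<dots> \<le> pi / real n * L + 24 * L / D" using 2 3 by linarith
      finally show ?thesis using False by (simp add: D_def mult_ac)
    qed
    have "(\<Sum>k<n - 1. \<bar>\<phi> k - \<phi> (Suc k)\<bar>) \<le> (\<Sum>k<n - 1. L * pi / real n +
        (if Suc k = m then 2 * L else 0) + 24 * L * (1 / \<bar>real (Suc k) - real m\<bar>))"
      using diff by (intro sum_mono) auto
    also have "\<dots> = real (n - 1) * (L * pi / real n) + (\<Sum>k<n - 1. if Suc k = m then 2 * L else 0)
        + 24 * L * (\<Sum>k<n - 1. 1 / \<bar>real (Suc k) - real m\<bar>)"
      by (simp only: sum.distrib sum_distrib_left sum_constant card_lessThan)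
    also have "\<dots> \<le> 4 * L + 2 * L + 24 * L * (2 * (1 + ln (real n)))"
    proof (intro add_mono mult_left_mono)
      have "real (n - 1) * (L * pi / real n) \<le> real n * (L * pi / real n)"
        using L by (intro mult_right_mono) auto
      also have "\<dots> \<le> 4 * L"
        using n L pi_less_4 mult_left_mono[of pi 4 L] by simp
      finally show "real (n - 1) * (L * pi / real n) \<le> 4 * L" .
      \<comment> \<open>For m = 0 no \<open>k\<close> satisfies \<open>Suc k = m\<close>, but the
        truncated \<open>m - 1\<close> is 0; hence only an inequality.\<close>
      have "(\<Sum>k<n - 1. if Suc k = m then 2 * L else 0) \<le> (\<Sum>k<n - 1. if k = m - 1 then 2 * L else 0)"
        using L by (intro sum_mono) auto
      also have "\<dots> \<le> 2 * L" using L by simp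
      finally show "(\<Sum>k<n - 1. if Suc k = m then 2 * L else 0) \<le> 2 * L" .
      have "(\<Sum>k<n - 1. 1 / \<bar>real (Suc k) - real m\<bar>) = (\<Sum>j\<in>Suc ` {..<n - 1}. 1 / \<bar>real j - real m\<bar>)"
        by (subst sum.reindex) auto
      also have "\<dots> \<le> (\<Sum>j<n. 1 / \<bar>real j - real m\<bar>)"
        by (intro sum_mono2) auto
      also have "\<dots> \<le> 2 * harm n"
        by (rule sum_inverse_dist_le_harm[OF mn])
      also have "\<dots> \<le> 2 * (1 + ln (real n))"
        using harm_le_ln[OF n] by simp
      finally show "(\<Sum>k<n - 1. 1 / \<bar>real (Suc k) - real m\<bar>) \<le> 2 * (1 + ln (real n))" .
    qed (use L in auto)
    finally have TV: "(\<Sum>k<n - 1. \<bar>\<phi> k - \<phi> (Suc k)\<bar>) \<le> L * (54 + 48 * ln (real n))"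
      by (simp add: algebra_simps)
    \<comment> \<open>Since \<open>x\<close> is fixed, f(x) enters as a constant polynomial, and the
      left-hand side is the error itself.\<close>
    have "poly (p - [:f x:]) x = poly (chebyshev_poly n) x / real n * (\<Sum>k<n. (-1) ^ k * \<phi> k)"
      using deg n ne p
      by (subst cheb_interpolation_formula[OF n])
         (auto simp: s_def \<phi>_def q_def intro!: sum.cong degree_diff_less)
    then have "\<bar>poly p x - f x\<bar> = \<bar>poly (chebyshev_poly n) x\<bar> / real n * \<bar>\<Sum>k<n. (-1) ^ k * \<phi> k\<bar>"
      by (simp add: abs_mult)
    also have "\<dots> \<le> 1 / real n * (L + L * (54 + 48 * ln (real n)))"
      using alternating_sum_bound[of n \<phi> L, OF n \<phi>] TV
      by (intro mult_mono divide_right_mono) (auto simp: chebyshev_poly_cos simp flip: t(3))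
    also have "\<dots> = L * (55 + 48 * ln (real n)) / real n"
      by (simp add: algebra_simps add_divide_distrib)
    finally show ?thesis .
  qed
qed

section \<open>Lipschitz data on \<open>{a..b}\<close> and the spacing of the Chebyshev
  points\<close>

lemma McShane_extension:
  fixes x y :: "nat \<Rightarrow> real"
  assumes "0 \<le> L" and Lip: "\<And>i j. i \<le> N \<Longrightarrow> j \<le> N \<Longrightarrow> \<bar>y i - y j\<bar> \<le> L * \<bar>x i - x j\<bar>"
  obtains f :: "real \<Rightarrow> real" where "\<And>i. i \<le> N \<Longrightarrow> f (x i) = y i"
    and "\<And>s t. \<bar>f s - f t\<bar> \<le> L * \<bar>s - t\<bar>"
proof
  define f where "f s = Min ((\<lambda>i. y i + L * \<bar>s - x i\<bar>) ` {..N})" for s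
  show "f (x i) = y i" if "i \<le> N" for i
    unfolding f_def
  proof (rule Min_eqI)
    fix z assume "z \<in> (\<lambda>j. y j + L * \<bar>x i - x j\<bar>) ` {..N}"
    then obtain j where "j \<le> N" "z = y j + L * \<bar>x i - x j\<bar>" by auto
    then show "y i \<le> z" using Lip[OF that, of j] by auto
  qed (use that in \<open>auto intro!: image_eqI[of _ _ i]\<close>)
  have le: "f s \<le> f t + L * \<bar>s - t\<bar>" for s t
  proof -
    have "f t \<in> (\<lambda>i. y i + L * \<bar>t - x i\<bar>) ` {..N}"
      unfolding f_def by (rule Min_in) auto
    then obtain i where i: "i \<le> N" "f t = y i + L * \<bar>t - x i\<bar>" by auto
    have "f s \<le> y i + L * \<bar>s - x i\<bar>"
      unfolding f_def using i by (intro Min_le) auto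
    also have "\<dots> \<le> y i + L * (\<bar>t - x i\<bar> + \<bar>s - t\<bar>)"
      using assms(1) by (intro add_left_mono mult_left_mono) auto
    finally show ?thesis using i by (simp add: algebra_simps)
  qed
  show "\<bar>f s - f t\<bar> \<le> L * \<bar>s - t\<bar>" for s t
    using le[of s t] le[of t s] by (simp add: abs_le_iff abs_minus_commute)
qed

lemma chebyshev_point_in: "a < b \<Longrightarrow> i \<le> N \<Longrightarrow> chebyshev_point a b N i \<in> {a..b}"
proof -
  assume "a < b" "i \<le> N"
  moreover have "\<bar>(b - a) / 2 * cos (cheb_angle (N + 1) (N - i))\<bar> \<le> (b - a) / 2 * 1"
    unfolding abs_mult using \<open>a < b\<close> by (intro mult_mono) auto
  ultimately show ?thesis
    unfolding chebyshev_point_eq[OF \<open>a < b\<close> \<open>i \<le> N\<close>] atLeastAtMost_iff abs_le_iff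
    by (simp add: field_simps)
qed

lemma chebyshev_point_less:
  assumes "a < b" "i < j" "j \<le> N"
  shows "chebyshev_point a b N i < chebyshev_point a b N j"
  using assms by (auto simp: chebyshev_point_eq intro!: cos_cheb_angle_less)

lemma chebyshev_point_mono:
  assumes "a < b" "i \<le> j" "j \<le> N"
  shows "chebyshev_point a b N i \<le> chebyshev_point a b N j"
  using chebyshev_point_less[OF assms(1), of i j N] assms by (cases "i = j") auto

text \<open>From e \<le> 3. This is the origin of \<open>3 \<le> N\<close> below and lets terms of
  order 1 / N be absorbed into \<open>ln (real N) / real N\<close>.\<close>

lemma ln_ge_one: "3 \<le> N \<Longrightarrow> 1 \<le> ln (real N)"
  using exp_le by (subst ln_ge_iff) auto

lemma chebyshev_point_gap:
  assumes "a < b" "i < N" "3 \<le> N"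
  shows "chebyshev_point a b N (Suc i) - chebyshev_point a b N i \<le> 2 * (b - a) * (ln (real N) / real N)"
proof -
  have "N - i = Suc (N - Suc i)" using assms by simp
  then have "chebyshev_point a b N (Suc i) - chebyshev_point a b N i =
      (b - a) / 2 * (cos (cheb_angle (N + 1) (N - Suc i)) - cos (cheb_angle (N + 1) (Suc (N - Suc i))))"
    using assms by (simp add: chebyshev_point_eq algebra_simps)
  also have "\<dots> \<le> (b - a) / 2 * (pi / real (N + 1))"
    using assms abs_cos_diff_le[of "cheb_angle (N + 1) (N - Suc i)" "cheb_angle (N + 1) (Suc (N - Suc i))"]
    unfolding cheb_angle_Suc by (intro mult_left_mono) auto
  also have "\<dots> \<le> (b - a) / 2 * (4 * ln (real N) / real N)"
    using assms pi_less_4 ln_ge_one[of N] by (intro mult_left_mono frac_le) auto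
  also have "\<dots> = 2 * (b - a) * (ln (real N) / real N)" by simp
  finally show ?thesis .
qed

lemma chebyshev_points_dense:
  assumes ab: "a < b" and N: "3 \<le> N" and t: "t \<in> {a..b}"
  obtains q where "q \<le> N" "\<bar>t - chebyshev_point a b N q\<bar> \<le> 2 * (b - a) * (ln (real N) / real N)"
proof -
  define s where "s = (2 * t - (a + b)) / (b - a)"
  have s: "t = (a + b) / 2 + (b - a) / 2 * s" "-1 \<le> s" "s \<le> 1"
    using ab t by (auto simp: s_def field_simps)
  define w where "w = arccos s"
  have w: "0 \<le> w" "w \<le> pi" "cos w = s"
    using s by (auto simp: w_def arccos_lbound arccos_ubound)
  define v where "v = real (N + 1) * w / pi"
  have v: "0 \<le> v" "v \<le> real (N + 1)"
    using w mult_left_mono[of w pi "real (N + 1)"] by (auto simp: v_def field_simps)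
  \<comment> \<open>At t = a the value of \<open>v\<close> is N + 1; the minimum keeps the index in
    range.\<close>
  define k where "k = min (nat \<lfloor>v\<rfloor>) N"
  have k: "k \<le> N" "\<bar>v - (real k + 1 / 2)\<bar> \<le> 1 / 2"
  proof -
    have v': "real (nat \<lfloor>v\<rfloor>) \<le> v" "v < real (nat \<lfloor>v\<rfloor>) + 1"
      using v by auto
    have "real k \<le> real (nat \<lfloor>v\<rfloor>)" unfolding k_def by (rule of_nat_mono) simp
    then have "real k \<le> v" using v' by linarith
    moreover have "v \<le> real k + 1" using v v' by (auto simp: k_def min_def)
    ultimately show "\<bar>v - (real k + 1 / 2)\<bar> \<le> 1 / 2"
      unfolding abs_le_iff by linarith
  qed (simp add: k_def)
  have "\<bar>t - chebyshev_point a b N (N - k)\<bar> = (b - a) / 2 * \<bar>cos w - cos (cheb_angle (N + 1) k)\<bar>"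
  proof -
    have eq: "t - chebyshev_point a b N (N - k) = (b - a) / 2 * (cos w - cos (cheb_angle (N + 1) k))"
      using ab k(1) by (simp add: chebyshev_point_eq s(1) w(3) right_diff_distrib)
    show ?thesis unfolding eq abs_mult using ab by simp
  qed
  also have "\<dots> \<le> (b - a) / 2 * (pi / real (N + 1))"
  proof (intro mult_left_mono)
    have "w - cheb_angle (N + 1) k = pi / real (N + 1) * (v - (real k + 1 / 2))"
    proof -
      have "pi / real (N + 1) * v = w" by (simp add: v_def)
      moreover have "pi / real (N + 1) * (real k + 1 / 2) = cheb_angle (N + 1) k"
        by (simp add: cheb_angle_def field_simps)
      ultimately show ?thesis by (simp only: right_diff_distrib)
    qed
    then have "\<bar>w - cheb_angle (N + 1) k\<bar> = pi / real (N + 1) * \<bar>v - (real k + 1 / 2)\<bar>"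
      by (simp add: abs_mult)
    also have "\<dots> \<le> pi / real (N + 1) * 1"
      using k(2) by (intro mult_left_mono) auto
    finally show "\<bar>cos w - cos (cheb_angle (N + 1) k)\<bar> \<le> pi / real (N + 1)"
      using abs_cos_diff_le[of w "cheb_angle (N + 1) k"] by simp
  qed (use ab in simp)
  also have "\<dots> \<le> (b - a) / 2 * (4 * ln (real N) / real N)"
    using ab N pi_less_4 ln_ge_one[of N] by (intro mult_left_mono frac_le) auto
  also have "\<dots> = 2 * (b - a) * (ln (real N) / real N)" by simp
  finally show ?thesis using that[of "N - k"] by simp
qed

text \<open>The polynomials of a hole are tied to \<open>g\<close> and \<open>h\<close> only at the
  nodes \<open>n..m\<close> inside the hole, while \<open>t\<close> ranges up to the neighbouring
  nodes on either side. If the node to the left of \<open>t\<close> is \<open>n - 1\<close>, its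
  right neighbour \<open>n\<close> serves instead.\<close>

lemma chebyshev_point_near_between:
  fixes a b :: real
  defines "x \<equiv> chebyshev_point a b"
  assumes ab: "a < b" and N: "3 \<le> N" and nm: "0 < n" "n \<le> m" "m < N"
    and t: "x N (n - 1) \<le> t" "t \<le> x N (m + 1)"
  obtains q where "q \<in> {n..m}" "\<bar>t - x N q\<bar> \<le> 2 * (b - a) * (ln (real N) / real N)"
proof -
  define A where "A = {q \<in> {n - 1..m}. x N q \<le> t}"
  have A: "finite A" "n - 1 \<in> A" using nm t by (auto simp: A_def)
  define q where "q = Max A"
  have "q \<in> A" unfolding q_def using A by (intro Max_in) auto
  then have q: "n - 1 \<le> q" "q \<le> m" "x N q \<le> t" by (auto simp: A_def)
  have q': "t \<le> x N (Suc q)"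
  proof (cases "q = m")
    case False
    have "Suc q \<notin> A" using Max_ge[OF A(1), of "Suc q", folded q_def] by auto
    then show ?thesis using False q by (auto simp: A_def)
  qed (use t in auto)
  have gap: "x N (Suc q) - x N q \<le> 2 * (b - a) * (ln (real N) / real N)"
    using chebyshev_point_gap[OF ab _ N, of q] q nm by (simp add: x_def)
  show ?thesis
  proof (cases "n \<le> q")
    case True
    then show ?thesis using that[of q] q q' gap by auto
  next
    case False
    then have "Suc q = n" using q by linarith
    then show ?thesis using that[of "Suc q"] q q' gap nm by auto
  qed
qed

text \<open>The Lipschitz extension depends on \<open>p\<close> and \<open>N\<close> and stays
  inside the proof; the conclusion refers to sample values alone.\<close>

lemma cheb_interpolation_Lipschitz_data:
  fixes a b L :: real
  defines "x \<equiv> chebyshev_point a b"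
  assumes ab: "a < b" and L: "0 \<le> L" and N: "3 \<le> N" and deg: "degree p \<le> N"
    and Lip: "\<And>i j. i \<le> N \<Longrightarrow> j \<le> N \<Longrightarrow>
       \<bar>poly p (x N i) - poly p (x N j)\<bar> \<le> L * \<bar>x N i - x N j\<bar>"
    and t: "t \<in> {a..b}" and q: "q \<le> N"
  shows "\<bar>poly p t - poly p (x N q)\<bar> \<le> L * \<bar>t - x N q\<bar> + 76 * L * (b - a) * (ln (real N) / real N)"
proof -
  obtain f where f: "\<And>i. i \<le> N \<Longrightarrow> f (x N i) = poly p (x N i)"
    and fL: "\<And>s t. \<bar>f s - f t\<bar> \<le> L * \<bar>s - t\<bar>"
    by (rule McShane_extension[OF L, of N "\<lambda>i. poly p (x N i)" "x N"]) (use Lip in auto)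
  define A where "A s = (a + b) / 2 + (b - a) / 2 * s" for s
  define P where "P = pcompose p [:(a + b) / 2, (b - a) / 2:]"
  have P: "poly P s = poly p (A s)" for s
    by (simp add: P_def poly_pcompose A_def algebra_simps)
  define s where "s = (2 * t - (a + b)) / (b - a)"
  have s: "A s = t" "s \<in> {-1..1}"
    using ab t by (auto simp: A_def s_def field_simps)
  have "\<bar>poly P s - f (A s)\<bar> \<le> (L * ((b - a) / 2)) * (55 + 48 * ln (real (N + 1))) / real (N + 1)"
  proof (rule cheb_interpolation_error)
    show "degree P < N + 1"
      using deg degree_pcompose_le[of p "[:(a + b) / 2, (b - a) / 2:]"] ab
      by (simp add: P_def)
    show "poly P (cos (cheb_angle (N + 1) k)) = f (A (cos (cheb_angle (N + 1) k)))"
      if "k < N + 1" for k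
      using that f[of "N - k"] ab by (simp add: P x_def chebyshev_point_eq A_def)
    show "\<bar>f (A y) - f (A z)\<bar> \<le> L * ((b - a) / 2) * \<bar>y - z\<bar>" for y z
    proof -
      have eq: "A y - A z = (b - a) / 2 * (y - z)" by (simp add: A_def right_diff_distrib)
      show ?thesis using fL[of "A y" "A z"] ab unfolding eq abs_mult by simp
    qed
  qed (use s in auto)
  \<comment> \<open>As N + 1 is at most N^2, the bracket is at most 55 + 96 ln N, which ln N \<ge> 1
    brings below 152 ln N. Half of 152 is the constant 76.\<close>
  also have "\<dots> \<le> (L * ((b - a) / 2)) * (152 * ln (real N)) / real N"
  proof (intro frac_le mult_left_mono)
    have "real (N + 1) \<le> real N ^ 2"
    proof -
      have "N + 1 \<le> N * 2" using N by simp
      also have "\<dots> \<le> N * N" using N by (intro mult_left_mono) auto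
      finally show ?thesis by (simp add: power2_eq_square flip: of_nat_mult)
    qed
    then have "ln (real (N + 1)) \<le> ln (real N ^ 2)"
      using N by (subst ln_le_cancel_iff) auto
    also have "\<dots> = 2 * ln (real N)"
      using N by (subst ln_realpow) auto
    finally show "55 + 48 * ln (real (N + 1)) \<le> 152 * ln (real N)"
      using ln_ge_one[OF N] by simp
  qed (use N L ab ln_ge_one[OF N] in auto)
  also have "\<dots> = 76 * L * (b - a) * (ln (real N) / real N)" by simp
  finally have 1: "\<bar>poly p t - f t\<bar> \<le> 76 * L * (b - a) * (ln (real N) / real N)"
    by (simp only: P s)
  have "\<bar>f t - poly p (x N q)\<bar> \<le> L * \<bar>t - x N q\<bar>"
    using fL[of t "x N q"] f[OF q] by simp
  then show ?thesis
    using 1 abs_triangle_ineq[of "poly p t - f t" "f t - poly p (x N q)"] by simp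
qed

section \<open>Set-valued functions and metric chains\<close>

lemma Kstar_compact: "A \<in> Kstar \<Longrightarrow> compact A" and Kstar_nonempty: "A \<in> Kstar \<Longrightarrow> A \<noteq> {}"
  by (auto simp: Kstar_def intro!: compact_Union)

lemma hausdorff_dist_commute: "hausdorff_dist A B = hausdorff_dist B A"
  by (simp add: hausdorff_dist_def max.commute)

lemma hausdorff_dist_le:
  assumes "A \<noteq> {}" "B \<noteq> {}"
    and "\<And>x. x \<in> A \<Longrightarrow> \<exists>y\<in>B. \<bar>x - y\<bar> \<le> e" "\<And>y. y \<in> B \<Longrightarrow> \<exists>x\<in>A. \<bar>x - y\<bar> \<le> e"
  shows "hausdorff_dist A B \<le> e"
  unfolding hausdorff_dist_def
proof (intro max.boundedI cSUP_least)
  show "infdist x B \<le> e" if "x \<in> A" for x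
    using assms(3)[OF that] by (auto intro: infdist_le2 simp: dist_real_def)
  show "infdist y A \<le> e" if "y \<in> B" for y
    using assms(4)[OF that] by (auto intro: infdist_le2 simp: dist_real_def abs_minus_commute)
qed (use assms in auto)

text \<open>Compactness bounds the distances, without which a real \<open>SUP\<close> carries no
  information.\<close>

lemma infdist_le_hausdorff_dist:
  assumes "compact A" "v \<in> A"
  shows "infdist v B \<le> hausdorff_dist A B"
proof -
  have "bdd_above ((\<lambda>x. infdist x B) ` A)"
    using assms by (intro bounded_imp_bdd_above compact_imp_bounded compact_continuous_image
        continuous_intros)
  then have "infdist v B \<le> (SUP x\<in>A. infdist x B)"
    using assms by (intro cSUP_upper)
  then show ?thesis by (simp add: hausdorff_dist_def)
qed

lemma svf_Lip_Kstar: "F \<in> svf_Lip a b L \<Longrightarrow> x \<in> {a..b} \<Longrightarrow> F x \<in> Kstar"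
  by (simp add: svf_Lip_def svf_def)

lemma svf_Lip_near:
  assumes F: "F \<in> svf_Lip a b L" and x: "x \<in> {a..b}" and y: "y \<in> {a..b}" and v: "v \<in> F x"
  obtains w where "w \<in> F y" "\<bar>v - w\<bar> \<le> L * \<bar>x - y\<bar>"
proof -
  have "compact (F x)" "compact (F y)" "F y \<noteq> {}"
    using svf_Lip_Kstar[OF F] x y Kstar_compact Kstar_nonempty by auto
  then obtain w where "w \<in> F y" "infdist v (F y) = dist v w"
    using infdist_attains_inf[of "F y" v] compact_imp_closed by blast
  moreover have "infdist v (F y) \<le> L * \<bar>x - y\<bar>"
    using F x y infdist_le_hausdorff_dist[OF \<open>compact (F x)\<close> v, of "F y"]
    by (force simp: svf_Lip_def)
  ultimately show ?thesis using that by (auto simp: dist_real_def)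
qed

lemma svf_bounds:
  assumes "F x \<in> Kstar"
  shows "lower_bd F x \<in> F x" "upper_bd F x \<in> F x"
    "y \<in> F x \<Longrightarrow> lower_bd F x \<le> y" "y \<in> F x \<Longrightarrow> y \<le> upper_bd F x"
  using Kstar_compact[OF assms] Kstar_nonempty[OF assms]
  by (auto simp: lower_bd_def upper_bd_def compact_imp_bounded compact_imp_closed bounded_imp_bdd_above
      bounded_imp_bdd_below intro!: closed_contains_Inf closed_contains_Sup cInf_lower cSup_upper)

lemma lower_bd_Lipschitz:
  assumes F: "F \<in> svf_Lip a b L" and "x \<in> {a..b}" "y \<in> {a..b}"
  shows "\<bar>lower_bd F x - lower_bd F y\<bar> \<le> L * \<bar>x - y\<bar>"
proof -
  have "lower_bd F y \<le> lower_bd F x + L * \<bar>x - y\<bar>" if xy: "x \<in> {a..b}" "y \<in> {a..b}" for x y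
  proof -
    note K = svf_bounds[of F, OF svf_Lip_Kstar[OF F]]
    obtain w where "w \<in> F y" "\<bar>lower_bd F x - w\<bar> \<le> L * \<bar>x - y\<bar>"
      using svf_Lip_near[OF F xy K(1)[OF xy(1)]] .
    then show ?thesis using K(3)[OF xy(2), of w] by linarith
  qed
  from this[of x y] this[of y x] show ?thesis
    using assms by (simp add: abs_le_iff abs_minus_commute)
qed

lemma upper_bd_Lipschitz:
  assumes F: "F \<in> svf_Lip a b L" and "x \<in> {a..b}" "y \<in> {a..b}"
  shows "\<bar>upper_bd F x - upper_bd F y\<bar> \<le> L * \<bar>x - y\<bar>"
proof -
  have "upper_bd F x - L * \<bar>x - y\<bar> \<le> upper_bd F y" if xy: "x \<in> {a..b}" "y \<in> {a..b}" for x y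
  proof -
    note K = svf_bounds[of F, OF svf_Lip_Kstar[OF F]]
    obtain w where "w \<in> F y" "\<bar>upper_bd F x - w\<bar> \<le> L * \<bar>x - y\<bar>"
      using svf_Lip_near[OF F xy K(2)[OF xy(1)]] .
    then show ?thesis using K(4)[OF xy(2), of w] by linarith
  qed
  from this[of x y] this[of y x] show ?thesis
    using assms by (simp add: abs_le_iff abs_minus_commute)
qed

text \<open>The right-hand sides are signed differences, so that they telescope along the increasing
  nodes.\<close>

lemma Lipschitz_steps:
  fixes x y :: "nat \<Rightarrow> real"
  assumes step: "\<And>i. i < N \<Longrightarrow> \<bar>y (Suc i) - y i\<bar> \<le> L * (x (Suc i) - x i)"
  shows "i \<le> j \<Longrightarrow> j \<le> N \<Longrightarrow> \<bar>y j - y i\<bar> \<le> L * (x j - x i)"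
proof (induction j rule: dec_induct)
  case (step j)
  have "\<bar>y (Suc j) - y i\<bar> \<le> \<bar>y (Suc j) - y j\<bar> + \<bar>y j - y i\<bar>" by simp
  then show ?case
    using assms[of j] step by (simp add: algebra_simps)
qed simp

text \<open>The bound is the same for every significant chain, so the arbitrary choices of the
  algorithm cannot affect the rate.\<close>

lemma chain_poly_error:
  fixes a b L :: real
  defines "x \<equiv> chebyshev_point a b"
  assumes ab: "a < b" and L: "0 < L" and N: "3 \<le> N" and F: "F \<in> svf_Lip a b L"
    and p: "p \<in> chain_polys N (x N) (\<lambda>i. F (x N i))"
    and t: "t \<in> {a..b}" and q: "q \<le> N"
  shows "\<bar>poly p t - poly p (x N q)\<bar> \<le> L * \<bar>t - x N q\<bar> + 76 * L * (b - a) * (ln (real N) / real N)"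
  unfolding x_def
proof (rule cheb_interpolation_Lipschitz_data)
  from p obtain f where f: "metric_chain N (\<lambda>i. F (x N i)) f"
    and pf: "\<And>i. i \<le> N \<Longrightarrow> poly p (x N i) = f i" and deg: "degree p \<le> N"
    by (auto simp: chain_polys_def significant_metric_chain_def)
  show "degree p \<le> N" by fact
  have x: "x N i \<in> {a..b}" if "i \<le> N" for i
    using chebyshev_point_in[OF ab that] by (simp add: x_def)
  have step: "\<bar>f (Suc i) - f i\<bar> \<le> L * (x N (Suc i) - x N i)" if i: "i < N" for i
  proof -
    let ?A = "F (x N i)" and ?B = "F (x N (Suc i))"
    have AB: "compact ?A" "compact ?B"
      using x[of i] x[of "Suc i"] i svf_Lip_Kstar[OF F] Kstar_compact by auto
    have "(f i, f (Suc i)) \<in> metric_pairs ?A ?B"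
      using f i by (auto simp: metric_chain_def)
    then have "\<bar>f (Suc i) - f i\<bar> \<le> hausdorff_dist ?A ?B"
      using infdist_le_hausdorff_dist[OF AB(1), of "f i" ?B]
        infdist_le_hausdorff_dist[OF AB(2), of "f (Suc i)" ?A]
      by (auto simp: metric_pairs_def metric_proj_def hausdorff_dist_commute abs_minus_commute)
    also have "\<dots> \<le> L * \<bar>x N i - x N (Suc i)\<bar>"
      using F x[of i] x[of "Suc i"] i by (auto simp: svf_Lip_def)
    also have "\<bar>x N i - x N (Suc i)\<bar> = x N (Suc i) - x N i"
      using chebyshev_point_less[OF ab, of i "Suc i" N] i by (simp add: x_def)
    finally show ?thesis .
  qed
  have "\<bar>f j - f i\<bar> \<le> L * \<bar>x N j - x N i\<bar>" if "i \<le> j" "j \<le> N" for i j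
    using Lipschitz_steps[of N f L "x N", OF step that] chebyshev_point_mono[OF ab that]
    by (simp add: x_def)
  then show "\<bar>poly p (chebyshev_point a b N i) - poly p (chebyshev_point a b N j)\<bar>
      \<le> L * \<bar>chebyshev_point a b N i - chebyshev_point a b N j\<bar>" if "i \<le> N" "j \<le> N" for i j
    using that pf unfolding x_def by (metis abs_minus_commute nle_le)
qed (use assms in auto)

section \<open>The boundary functions of a hole\<close>

text \<open>Used with r = 1 / (n + 1) to approach a point of a closed interval from its
  interior.\<close>

lemma convex_combination_inside:
  fixes p q u v r :: real
  assumes "p < u" "u < q" "p \<le> v" "v \<le> q" "0 < r" "r \<le> 1"
  shows "p < v + (u - v) * r \<and> v + (u - v) * r < q"
proof -
  have e: "v + (u - v) * r = r * u + (1 - r) * v" by (simp add: algebra_simps)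
  have "r * p < r * u" "(1 - r) * p \<le> (1 - r) * v" "r * u < r * q" "(1 - r) * v \<le> (1 - r) * q"
    using assms by (auto intro: mult_left_mono)
  moreover have "p = r * p + (1 - r) * p" "q = r * q + (1 - r) * q" by (auto simp: algebra_simps)
  ultimately show ?thesis unfolding e by linarith
qed

text \<open>No continuity at \<open>e\<close> is assumed. The values of \<open>f\<close> along a
  sequence tending to \<open>e\<close> form a Cauchy sequence, whose limit lies in the closed set
  \<open>K\<close> over \<open>e\<close>, where only \<open>f e\<close> is possible. For a hole,
  \<open>K\<close> is the boundary curve, which has a single point over either end.\<close>

lemma Lipschitz_endpoint:
  fixes f :: "real \<Rightarrow> real"
  assumes cd: "c < d" and e: "e \<in> {c, d}" and "closed K"
    and Lip: "\<And>x y. x \<in> {c<..<d} \<Longrightarrow> y \<in> {c<..<d} \<Longrightarrow> \<bar>f x - f y\<bar> \<le> L * \<bar>x - y\<bar>"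
    and K: "\<And>x. x \<in> {c<..<d} \<Longrightarrow> (x, f x) \<in> K" and Ke: "\<And>z. (e, z) \<in> K \<Longrightarrow> z = f e"
    and y: "y \<in> {c<..<d}"
  shows "\<bar>f e - f y\<bar> \<le> L * \<bar>e - y\<bar>"
proof -
  define x where "x n = e + ((c + d) / 2 - e) * inverse (real (Suc n))" for n
  have x: "x n \<in> {c<..<d}" for n
    using convex_combination_inside[of c "(c + d) / 2" d e "inverse (real (Suc n))"] e cd
    by (auto simp: x_def inverse_eq_divide)
  have lim: "x \<longlonglongrightarrow> e"
    unfolding x_def by (rule tendsto_eq_intros LIMSEQ_inverse_real_of_nat refl | simp)+
  have "Cauchy (\<lambda>n. f (x n))"
  proof (rule metric_CauchyI)
    fix r :: real assume "0 < r"
    have L: "0 \<le> L * \<bar>x n - x m\<bar>" for m n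
      using Lip[OF x[of n] x[of m]] abs_ge_zero order_trans by blast
    \<comment> \<open>Two distinct points are needed to read off the sign of \<open>L\<close>. The
      tolerance \<open>r / (L + 1)\<close> below also covers L = 0.\<close>
    have L0: "0 \<le> L"
    proof -
      have "x 0 \<noteq> x 1" using e cd by (auto simp: x_def field_simps)
      then show ?thesis using L[of 0 1] by (simp add: zero_le_mult_iff)
    qed
    obtain M where M: "\<And>m n. M \<le> m \<Longrightarrow> M \<le> n \<Longrightarrow> dist (x m) (x n) < r / (L + 1)"
      using metric_CauchyD[OF LIMSEQ_imp_Cauchy[OF lim], of "r / (L + 1)"] \<open>0 < r\<close> L0 by auto
    show "\<exists>M. \<forall>m\<ge>M. \<forall>n\<ge>M. dist (f (x m)) (f (x n)) < r"
    proof (intro exI allI impI)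
      fix m n assume mn: "M \<le> m" "M \<le> n"
      have "dist (f (x m)) (f (x n)) \<le> (L + 1) * dist (x m) (x n)"
        using Lip[OF x[of m] x[of n]] by (simp add: dist_real_def algebra_simps add_increasing2)
      also have "\<dots> < r"
        using M[OF mn] L0 by (simp add: field_simps)
      finally show "dist (f (x m)) (f (x n)) < r" .
    qed
  qed
  then obtain z where z: "(\<lambda>n. f (x n)) \<longlonglongrightarrow> z"
    using Cauchy_convergent_iff convergent_def by blast
  have "(e, z) \<in> K"
    by (rule closed_sequentially[OF \<open>closed K\<close> _ tendsto_Pair[OF lim z]]) (use K x in auto)
  then have "z = f e" by (rule Ke)
  have "(\<lambda>n. \<bar>f (x n) - f y\<bar>) \<longlonglongrightarrow> \<bar>f e - f y\<bar>" "(\<lambda>n. L * \<bar>x n - y\<bar>) \<longlonglongrightarrow> L * \<bar>e - y\<bar>"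
    using z \<open>z = f e\<close> lim by (auto intro!: tendsto_intros)
  then show ?thesis
    by (rule LIMSEQ_le) (use Lip x y in auto)
qed

lemma Lipschitz_closed_interval:
  fixes f :: "real \<Rightarrow> real"
  assumes cd: "c < d" and "closed K"
    and Lip: "\<And>x y. x \<in> {c<..<d} \<Longrightarrow> y \<in> {c<..<d} \<Longrightarrow> \<bar>f x - f y\<bar> \<le> L * \<bar>x - y\<bar>"
    and K: "\<And>x. x \<in> {c<..<d} \<Longrightarrow> (x, f x) \<in> K"
    and Kc: "\<And>z. (c, z) \<in> K \<Longrightarrow> z = f c" and Kd: "\<And>z. (d, z) \<in> K \<Longrightarrow> z = f d"
    and xy: "x \<in> {c..d}" "y \<in> {c..d}"
  shows "\<bar>f x - f y\<bar> \<le> L * \<bar>x - y\<bar>"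
proof -
  have E: "\<bar>f e - f y\<bar> \<le> L * \<bar>e - y\<bar>" if "e \<in> {c, d}" "y \<in> {c<..<d}" for e y
    using Lipschitz_endpoint[of c d e K f L y] assms that by blast
  have m: "(c + d) / 2 \<in> {c<..<d}" using cd by auto
  \<comment> \<open>The detour through the midpoint costs nothing, as its distances to the two ends
    add up to d - c.\<close>
  have cd': "\<bar>f c - f d\<bar> \<le> L * \<bar>c - d\<bar>"
  proof -
    have "\<bar>f c - f d\<bar> \<le> \<bar>f c - f ((c + d) / 2)\<bar> + \<bar>f d - f ((c + d) / 2)\<bar>" by simp
    also have "\<dots> \<le> L * \<bar>c - (c + d) / 2\<bar> + L * \<bar>d - (c + d) / 2\<bar>"
      using E[OF _ m, of c] E[OF _ m, of d] by (intro add_mono) auto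
    also have "\<dots> = L * (\<bar>c - (c + d) / 2\<bar> + \<bar>d - (c + d) / 2\<bar>)" by (simp add: algebra_simps)
    also have "\<bar>c - (c + d) / 2\<bar> + \<bar>d - (c + d) / 2\<bar> = \<bar>c - d\<bar>" using cd by (simp add: abs_if field_simps)
    finally show ?thesis .
  qed
  have "x \<in> {c, d} \<or> x \<in> {c<..<d}" "y \<in> {c, d} \<or> y \<in> {c<..<d}" using xy by auto
  then show ?thesis
    using E[of x y] E[of y x] Lip[of x y] cd' by (auto simp: abs_minus_commute)
qed

text \<open>Openness acts as semicontinuity: near \<open>x\<close>, \<open>g\<close> stays below
  \<open>y\<close> and \<open>h\<close> above it.\<close>

lemma open_vertical_band:
  assumes "open (hole_region c d g h)" "(x, y) \<in> hole_region c d g h"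
  obtains r where "0 < r" "\<And>x'. \<bar>x' - x\<bar> < r \<Longrightarrow> (x', y) \<in> hole_region c d g h"
proof -
  obtain r where "0 < r" "ball (x, y) r \<subseteq> hole_region c d g h"
    using assms open_contains_ball by blast
  then show ?thesis
    using that[of r] by (auto simp: subset_iff dist_Pair_Pair dist_real_def abs_minus_commute)
qed

text \<open>
  Near an interior point the gap between \<open>g\<close> and \<open>h\<close> contains a fixed band; a point of \<open>F v\<close>
  close to \<open>g u\<close> lies below that band, hence below the whole gap over \<open>v\<close>.
\<close>

lemma hole_boundary_Lipschitz_interior:
  assumes F: "F \<in> svf_Lip a b L" and L: "0 < L" and ab: "{c..d} \<subseteq> {a..b}"
    and gF: "\<And>x. x \<in> {c..d} \<Longrightarrow> g x \<in> F x" and hF: "\<And>x. x \<in> {c..d} \<Longrightarrow> h x \<in> F x"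
    and gh: "\<And>x. x \<in> {c<..<d} \<Longrightarrow> g x < h x"
    and gap: "\<And>x y. (x, y) \<in> hole_region c d g h \<Longrightarrow> y \<notin> F x"
    and op: "open (hole_region c d g h)"
    and uv: "u \<in> {c<..<d}" "v \<in> {c<..<d}"
  shows "\<bar>g u - g v\<bar> \<le> L * \<bar>u - v\<bar> \<and> \<bar>h u - h v\<bar> \<le> L * \<bar>u - v\<bar>"
proof -
  define P where "P u v \<longleftrightarrow> \<bar>g u - g v\<bar> \<le> L * \<bar>u - v\<bar> \<and> \<bar>h u - h v\<bar> \<le> L * \<bar>u - v\<bar>" for u v
  \<comment> \<open>The gap closes towards the ends, so the radius of the local estimate is not
    uniform. \<open>Bolzano\<close> needs none: estimates over adjacent intervals add up.\<close>
  have "P u v" if "u \<le> v" "c < u" "v < d" for u v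
    using \<open>u \<le> v\<close>
  proof (rule Bolzano)
    fix x y z assume "P x y" "P y z" "x \<le> y" "y \<le> z"
    then have "\<bar>g x - g y\<bar> + \<bar>g y - g z\<bar> \<le> L * (z - x)" "\<bar>h x - h y\<bar> + \<bar>h y - h z\<bar> \<le> L * (z - x)"
      by (auto simp: P_def algebra_simps)
    then show "P x z"
      using \<open>x \<le> y\<close> \<open>y \<le> z\<close> by (auto simp: P_def)
  next
    fix x assume x: "u \<le> x" "x \<le> v"
    \<comment> \<open>The numbers \<open>y - \<rho>\<close> and \<open>y + \<rho>\<close> are the
      quarter points of the gap over \<open>x\<close>; the radius \<open>\<rho> / L\<close> below
      keeps the movement of values of \<open>F\<close> under \<open>\<rho>\<close>.\<close>
    define \<rho> where "\<rho> = (h x - g x) / 4"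
    define y where "y = (g x + h x) / 2"
    have xcd: "x \<in> {c<..<d}" using x that by auto
    then have \<rho>: "0 < \<rho>" "g x < y - \<rho>" "y + \<rho> < h x" "y - \<rho> < h x" "g x < y + \<rho>"
      using gh[of x] by (auto simp: \<rho>_def y_def field_simps)
    obtain r1 where r1: "0 < r1" "\<And>x'. \<bar>x' - x\<bar> < r1 \<Longrightarrow> (x', y - \<rho>) \<in> hole_region c d g h"
      using open_vertical_band[OF op, of x "y - \<rho>"] xcd \<rho> by (auto simp: hole_region_def)
    obtain r2 where r2: "0 < r2" "\<And>x'. \<bar>x' - x\<bar> < r2 \<Longrightarrow> (x', y + \<rho>) \<in> hole_region c d g h"
      using open_vertical_band[OF op, of x "y + \<rho>"] xcd \<rho> by (auto simp: hole_region_def)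
    define r where "r = min (min r1 r2) (\<rho> / L)"
    have r: "0 < r" using r1 r2 \<rho> L by (simp add: r_def)
    have near: "w \<in> {c<..<d}" "g w < y - \<rho>" "y + \<rho> < h w" if "\<bar>w - x\<bar> < r" for w
      using r1(2)[of w] r2(2)[of w] that by (auto simp: r_def hole_region_def)
    have one: "g s \<le> g w + L * \<bar>s - w\<bar> \<and> h w \<le> h s + L * \<bar>s - w\<bar>"
      if "\<bar>s - x\<bar> < r" "\<bar>w - x\<bar> < r" "\<bar>s - w\<bar> < r" for s w
    proof
      have sw: "s \<in> {a..b}" "w \<in> {a..b}" "s \<in> {c..d}"
        using near(1)[OF that(1)] near(1)[OF that(2)] ab by auto
      have small: "L * \<bar>s - w\<bar> < \<rho>"
        using that(3) L by (simp add: r_def field_simps)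
      have notgap: "z \<le> g w \<or> h w \<le> z" if "z \<in> F w" for z
        using gap[of w z] that near(1)[OF \<open>\<bar>w - x\<bar> < r\<close>] by (force simp: hole_region_def)
      obtain z where z: "z \<in> F w" "\<bar>g s - z\<bar> \<le> L * \<bar>s - w\<bar>"
        using svf_Lip_near[OF F sw(1,2) gF[OF sw(3)]] .
      then have "z < y" using near[OF that(1)] small by linarith
      then have "z \<le> g w" using notgap[OF z(1)] near[OF that(2)] \<rho> by linarith
      then show "g s \<le> g w + L * \<bar>s - w\<bar>" using z by linarith
      obtain z' where z': "z' \<in> F w" "\<bar>h s - z'\<bar> \<le> L * \<bar>s - w\<bar>"
        using svf_Lip_near[OF F sw(1,2) hF[OF sw(3)]] .
      then have "y < z'" using near[OF that(1)] small by linarith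
      then have "h w \<le> z'" using notgap[OF z'(1)] near[OF that(2)] \<rho> by linarith
      then show "h w \<le> h s + L * \<bar>s - w\<bar>" using z' by linarith
    qed
    have "P s w" if "s \<le> x \<and> x \<le> w \<and> w - s < r" for s w
    proof -
      have *: "\<bar>s - x\<bar> < r" "\<bar>w - x\<bar> < r" "\<bar>s - w\<bar> < r" "\<bar>w - s\<bar> < r" using that by auto
      show ?thesis
        using one[OF *(1,2,3)] one[OF *(2,1,4)] by (auto simp: P_def abs_le_iff abs_minus_commute)
    qed
    then show "\<exists>r>0. \<forall>s w. s \<le> x \<and> x \<le> w \<and> w - s < r \<longrightarrow> P s w"
      using r by blast
  qed
  from this[of u v] this[of v u] show ?thesis
    using uv by (cases "u \<le> v") (auto simp: P_def abs_minus_commute)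
qed

text \<open>Of the closed curve only \<open>op\<close> and \<open>cl\<close> remain: an inside is
  open, and a path image is compact.\<close>

locale svf_hole =
  fixes a b L :: real and F c d g h
  assumes F: "F \<in> svf_Lip a b L" and L: "0 < L" and cd: "c < d" and ab: "{c..d} \<subseteq> {a..b}"
    and gF: "\<And>x. x \<in> {c..d} \<Longrightarrow> g x \<in> F x" and hF: "\<And>x. x \<in> {c..d} \<Longrightarrow> h x \<in> F x"
    and gh_ends: "g c = h c" "g d = h d"
    and gh: "\<And>x. x \<in> {c<..<d} \<Longrightarrow> g x < h x"
    and gap: "\<And>x y. (x, y) \<in> hole_region c d g h \<Longrightarrow> y \<notin> F x"
    and op: "open (hole_region c d g h)" and cl: "closed (hole_curve c d g h)"
begin

lemma g_Lipschitz:
  assumes "x \<in> {c..d}" "y \<in> {c..d}"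
  shows "\<bar>g x - g y\<bar> \<le> L * \<bar>x - y\<bar>"
proof (rule Lipschitz_closed_interval[OF cd cl _ _ _ _ assms])
  show "\<bar>g u - g v\<bar> \<le> L * \<bar>u - v\<bar>" if "u \<in> {c<..<d}" "v \<in> {c<..<d}" for u v
    using hole_boundary_Lipschitz_interior[OF F L ab gF hF gh gap op that] by simp
qed (use gh_ends cd in \<open>auto simp: hole_curve_def\<close>)

lemma h_Lipschitz:
  assumes "x \<in> {c..d}" "y \<in> {c..d}"
  shows "\<bar>h x - h y\<bar> \<le> L * \<bar>x - y\<bar>"
proof (rule Lipschitz_closed_interval[OF cd cl _ _ _ _ assms])
  show "\<bar>h u - h v\<bar> \<le> L * \<bar>u - v\<bar>" if "u \<in> {c<..<d}" "v \<in> {c<..<d}" for u v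
    using hole_boundary_Lipschitz_interior[OF F L ab gF hF gh gap op that] by simp
qed (use gh_ends cd in \<open>auto simp: hole_curve_def\<close>)

lemma g_le_h: "x \<in> {c..d} \<Longrightarrow> g x \<le> h x"
  using gh[of x] gh_ends by (cases "x = c \<or> x = d") auto

lemma continuous_on_g: "continuous_on {c..d} g" and continuous_on_h: "continuous_on {c..d} h"
  using g_Lipschitz h_Lipschitz L
  by (auto intro!: lipschitz_on_continuous_on[of L] lipschitz_onI simp: dist_real_def)

lemma bounded_hole_region: "bounded (hole_region c d g h)"
proof -
  obtain B1 where B1: "\<forall>x\<in>{c..d}. \<bar>g x\<bar> \<le> B1"
    using compact_imp_bounded[OF compact_continuous_image[OF continuous_on_g]] by (auto simp: bounded_iff)
  obtain B2 where B2: "\<forall>x\<in>{c..d}. \<bar>h x\<bar> \<le> B2"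
    using compact_imp_bounded[OF compact_continuous_image[OF continuous_on_h]] by (auto simp: bounded_iff)
  have "hole_region c d g h \<subseteq> {c..d} \<times> {-B1..B2}"
  proof (clarsimp simp: hole_region_def)
    fix x y assume "c < x" "x < d" "g x < y" "y < h x"
    then show "- B1 \<le> y \<and> y \<le> B2" using B1[rule_format, of x] B2[rule_format, of x] by auto
  qed
  then show ?thesis
    by (rule bounded_subset[rotated]) (intro bounded_Times bounded_closed_interval)
qed

text \<open>The open region has no points over \<open>c\<close> and \<open>d\<close>. This carries
  the disjointness of closures over to the full closed sections, points of change of topology
  included.\<close>

lemma closure_hole_region:
  assumes x: "x \<in> {c..d}" and y: "g x \<le> y" "y \<le> h x"
  shows "(x, y) \<in> closure (hole_region c d g h)"
proof -
  define X where "X n = x + ((c + d) / 2 - x) * inverse (real (Suc n))" for n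
  define m where "m n = (g (X n) + h (X n)) / 2" for n
  \<comment> \<open>Clamping \<open>y\<close> to the section over \<open>X n\<close> does no harm in
    the limit, because \<open>y\<close> lies in the section over \<open>x\<close>.\<close>
  define w where "w n = max (g (X n)) (min (h (X n)) y)" for n
  define Y where "Y n = w n + (m n - w n) * inverse (real (Suc n))" for n
  have X: "X n \<in> {c<..<d}" for n
    using convex_combination_inside[of c "(c + d) / 2" d x "inverse (real (Suc n))"] x cd
    by (auto simp: X_def inverse_eq_divide)
  have XY: "(X n, Y n) \<in> hole_region c d g h" for n
    using X[of n] gh[OF X[of n]]
      convex_combination_inside[of "g (X n)" "m n" "h (X n)" "w n" "inverse (real (Suc n))"]
    by (auto simp: hole_region_def Y_def m_def w_def inverse_eq_divide)
  have "(\<lambda>n. (X n, Y n)) \<longlonglongrightarrow> (x, y)"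
  proof (rule tendsto_Pair)
    show X_lim: "X \<longlonglongrightarrow> x"
      unfolding X_def by (rule tendsto_eq_intros LIMSEQ_inverse_real_of_nat refl | simp)+
    have Xi: "\<forall>\<^sub>F n in sequentially. X n \<in> {c..d}"
      using X by (intro always_eventually allI) (auto simp: less_imp_le)
    have G: "(\<lambda>n. g (X n)) \<longlonglongrightarrow> g x" "(\<lambda>n. h (X n)) \<longlonglongrightarrow> h x"
      using continuous_on_tendsto_compose[OF continuous_on_g X_lim x Xi]
        continuous_on_tendsto_compose[OF continuous_on_h X_lim x Xi] by auto
    let ?w = "max (g x) (min (h x) y)"
    have "Y \<longlonglongrightarrow> ?w + ((g x + h x) / 2 - ?w) * 0"
      unfolding Y_def m_def w_def by (intro tendsto_intros G LIMSEQ_inverse_real_of_nat) auto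
    then show "Y \<longlonglongrightarrow> y" using y by simp
  qed
  then show ?thesis
    unfolding closure_sequential using XY by (intro exI conjI allI)
qed

end

section \<open>Comparison of boundary representations\<close>

text \<open>In this form the sorting disappears, and two representations can be compared gap by gap.
  Minima and maxima occur because approximating polynomials may cross; the gap is then empty and the
  two segments next to it overlap.\<close>

lemma boundary_rep_eq_segment_minus_gaps:
  fixes g h :: "nat \<Rightarrow> real \<Rightarrow> real" and c d :: "nat \<Rightarrow> real" and M :: nat and x :: real
  defines "I \<equiv> {i. i < M \<and> x \<in> {c i..d i}}"
  assumes sep: "\<And>i j. i \<in> I \<Longrightarrow> j \<in> I \<Longrightarrow> i \<noteq> j \<Longrightarrow>
      max (g i x) (h i x) < min (g j x) (h j x) \<or> max (g j x) (h j x) < min (g i x) (h i x)"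
    and l: "\<And>i. i \<in> I \<Longrightarrow> l x \<le> min (g i x) (h i x)"
    and u: "\<And>i. i \<in> I \<Longrightarrow> max (g i x) (h i x) \<le> u x"
  shows "boundary_rep l u M c d g h x = closed_segment (l x) (u x) - (\<Union>i\<in>I. {g i x<..<h i x})"
proof -
  define ks where "ks = sort_key (\<lambda>i. g i x) (sorted_list_of_set (I))"
  define J where "J = length ks"
  define p where "p j = g (ks ! j) x" for j
  define q where "q j = h (ks ! j) x" for j
  have "finite (I)" by (simp add: I_def)
  then have set_ks: "set ks = I" and dist: "distinct ks"
    by (simp_all add: ks_def)
  have inI: "ks ! j \<in> I" if "j < J" for j
    using that set_ks nth_mem by (force simp: J_def)
  have I_eq: "I = (\<lambda>j. ks ! j) ` {..<J}"
    by (auto simp: set_ks[symmetric] J_def in_set_conv_nth)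
  have ord: "p j < p k" "q j < p k" "p j < q k" "q j < q k" if "j < k" "k < J" for j k
  proof -
    have "ks ! j \<noteq> ks ! k" using dist that by (simp add: J_def nth_eq_iff_index_eq)
    moreover have "p j \<le> p k"
      using that sorted_nth_mono[of "map (\<lambda>i. g i x) ks" j k]
      by (simp add: ks_def J_def p_def)
    ultimately show "p j < p k" "q j < p k" "p j < q k" "q j < q k"
      using sep[OF inI inI, of j k] that by (auto simp: p_def q_def)
  qed
  have lp: "l x \<le> p j" "l x \<le> q j" "p j \<le> u x" "q j \<le> u x" if "j < J" for j
    using l[OF inI[OF that]] u[OF inI[OF that]] by (auto simp: p_def q_def)
  have rep: "boundary_rep l u M c d g h x = (if J = 0 then closed_segment (l x) (u x)
      else closed_segment (l x) (p 0) \<union> (\<Union>j<J - 1. closed_segment (q j) (p (Suc j)))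
        \<union> closed_segment (q (J - 1)) (u x))"
    by (simp only: boundary_rep_def Let_def ks_def J_def p_def q_def I_def)
  show ?thesis
  proof (cases "J = 0")
    case True
    then show ?thesis using rep I_eq by simp
  next
    case False
    have lu: "l x \<le> u x" using lp[of 0] False by linarith
    have "boundary_rep l u M c d g h x =
        {l x..p 0} \<union> (\<Union>j<J - 1. {q j..p (Suc j)}) \<union> {q (J - 1)..u x}"
      using rep False lp[of 0] lp[of "J - 1"] ord(2)
      by (auto simp: closed_segment_eq_real_ivl less_imp_le)
    also have "\<dots> = {l x..u x} - (\<Union>j<J. {p j<..<q j})"
    proof (intro set_eqI iffI)
      fix z assume "z \<in> {l x..p 0} \<union> (\<Union>j<J - 1. {q j..p (Suc j)}) \<union> {q (J - 1)..u x}"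
      then consider "l x \<le> z" "z \<le> p 0" | j where "j < J - 1" "q j \<le> z" "z \<le> p (Suc j)"
        | "q (J - 1) \<le> z" "z \<le> u x" by auto
      then show "z \<in> {l x..u x} - (\<Union>j<J. {p j<..<q j})"
      proof cases
        case 1
        have "z \<le> p k" if "k < J" for k
          using 1 ord(1)[of 0 k] that by (cases "k = 0") auto
        then show ?thesis using 1 lp[of 0] False by force
      next
        case (2 j)
        then have j: "Suc j < J" by simp
        have "z \<le> p k \<or> q k \<le> z" if "k < J" for k
        proof -
          consider "k < j" | "k = j" | "k = Suc j" | "Suc j < k" by linarith
          then show ?thesis
            using 2 j ord(1)[of "Suc j" k] ord(4)[of k j] that by cases auto
        qed
        then show ?thesis using 2 j lp[of j] lp[of "Suc j"] by force
      next
        case 3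
        have "q k \<le> z" if "k < J" for k
        proof -
          from that consider "k = J - 1" | "k < J - 1" by linarith
          then show ?thesis using 3 ord(4)[of k "J - 1"] that by cases auto
        qed
        moreover have "l x \<le> q (J - 1)" using lp(2)[of "J - 1"] False by simp
        ultimately show ?thesis using 3 by fastforce
      qed
    next
      fix z assume z: "z \<in> {l x..u x} - (\<Union>j<J. {p j<..<q j})"
      then have gap: "z \<le> p k \<or> q k \<le> z" if "k < J" for k
        using that by force
      show "z \<in> {l x..p 0} \<union> (\<Union>j<J - 1. {q j..p (Suc j)}) \<union> {q (J - 1)..u x}"
      proof (cases "z \<le> p 0")
        case False
        define A where "A = {k. k < J \<and> q k \<le> z}"
        have A: "finite A" "0 \<in> A"
          using gap[of 0] False \<open>J \<noteq> 0\<close> by (auto simp: A_def)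
        \<comment> \<open>The last gap that ends at or before \<open>z\<close>.\<close>
        define j where "j = Max A"
        have "j \<in> A" unfolding j_def using A by (intro Max_in) auto
        then have j: "j < J" "q j \<le> z" by (auto simp: A_def)
        show ?thesis
        proof (cases "Suc j < J")
          case True
          have "Suc j \<notin> A" using Max_ge[OF A(1), of "Suc j", folded j_def] by auto
          then have "z \<le> p (Suc j)" using True gap[of "Suc j"] by (auto simp: A_def)
          then have "z \<in> {q j..p (Suc j)}" "j \<in> {..<J - 1}" using j True by auto
          then show ?thesis by blast
        next
          case False
          then have "j = J - 1" using j by simp
          then show ?thesis using j z by simp
        qed
      qed (use z in auto)
    qed
    finally show ?thesis
      unfolding I_eq p_def q_def using lu by (simp add: closed_segment_eq_real_ivl)
  qed
qed

text \<open>A point of one set that falls into a gap of the other is moved to an end of that gap, so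
  gap ends must belong to the sets. A gap without a counterpart has to be thin.\<close>

lemma hausdorff_dist_segment_minus_gaps:
  fixes g h g' h' :: "nat \<Rightarrow> real" and l u l' u' e :: real and I I' :: "nat set"
  defines "A \<equiv> {l..u} - (\<Union>i\<in>I. {g i<..<h i})"
    and "B \<equiv> closed_segment l' u' - (\<Union>i\<in>I'. {g' i<..<h' i})"
  assumes A: "l \<in> A" "u \<in> A" "\<And>i. i \<in> I \<Longrightarrow> g i \<in> A \<and> h i \<in> A"
    and B: "\<And>i. i \<in> I' \<Longrightarrow> g' i \<in> B \<and> h' i \<in> B"
    and I: "I \<subseteq> I'"
    and close: "\<And>i. i \<in> I \<Longrightarrow> \<bar>g' i - g i\<bar> \<le> e \<and> \<bar>h' i - h i\<bar> \<le> e"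
    and thin: "\<And>i. i \<in> I' - I \<Longrightarrow> h' i \<le> g' i + 2 * e"
    and lu: "\<bar>l' - l\<bar> \<le> e" "\<bar>u' - u\<bar> \<le> e"
  shows "hausdorff_dist B A \<le> 3 * e"
proof (rule hausdorff_dist_le)
  have e: "0 \<le> e" using lu by linarith
  show near_A: "\<exists>z\<in>A. \<bar>y - z\<bar> \<le> 3 * e" if y: "y \<in> B" for y
  proof -
    \<comment> \<open>Even if \<open>u' < l'\<close>, the segment stays within \<open>e\<close> of
      \<open>{l..u}\<close>, because \<open>l \<in> A\<close> gives l \<le> u.\<close>
    have yb: "l - e \<le> y" "y \<le> u + e"
      using y lu A(1) by (auto simp: A_def B_def closed_segment_eq_real_ivl split: if_splits)
    consider "y < l" | "u < y" | "y \<in> A" | i where "i \<in> I" "g i < y" "y < h i"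
      by (force simp: A_def)
    then show ?thesis
    proof cases
      case (4 i)
      then have "y \<le> g' i \<or> h' i \<le> y" using y I by (force simp: B_def)
      then have "\<bar>y - g i\<bar> \<le> 3 * e \<or> \<bar>y - h i\<bar> \<le> 3 * e" using 4 close[OF 4(1)] e by linarith
      then show ?thesis using A(3)[OF 4(1)] by blast
    qed (use yb A e in \<open>force intro: bexI[of _ l] bexI[of _ u] bexI[of _ y]\<close>)+
  qed
  show near_B: "\<exists>y\<in>B. \<bar>y - z\<bar> \<le> 3 * e" if z: "z \<in> A" for z
  proof -
    define z' where "z' = min (max z (min l' u')) (max l' u')"
    have z': "z' \<in> closed_segment l' u'" "\<bar>z' - z\<bar> \<le> e"
      using z lu by (auto simp: z'_def A_def closed_segment_eq_real_ivl min_def max_def)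
    show ?thesis
    proof (cases "z' \<in> B")
      case True
      then show ?thesis using z' e by (intro bexI[of _ z']) auto
    next
      case False
      then obtain i where i: "i \<in> I'" "g' i < z'" "z' < h' i"
        using z' by (auto simp: B_def)
      have "\<bar>g' i - z\<bar> \<le> 3 * e \<or> \<bar>h' i - z\<bar> \<le> 3 * e"
      proof (cases "i \<in> I")
        case True
        then have "z \<le> g i \<or> h i \<le> z" using z by (force simp: A_def)
        then show ?thesis using close[OF True] i z' by linarith
      next
        case False
        \<comment> \<open>A thin gap has length at most \<open>2 * e\<close>, and \<open>z'\<close>
          is within \<open>e\<close> of \<open>z\<close>: the source of the factor 3.\<close>
        then show ?thesis using thin[of i] i z' by auto
      qed
      then show ?thesis using B[OF i(1)] by blast
    qed
  qed
  show "A \<noteq> {}" using A by auto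
  then show "B \<noteq> {}" using near_B by blast
qed

section \<open>Uniform separation of the holes\<close>

lemma holes_of_svf_hole:
  assumes F: "F \<in> svf_Lip a b L" "0 < L" and H: "holes_of a b F M c d g h" and i: "i < M"
  shows "svf_hole a b L F (c i) (d i) (g i) (h i)"
proof
  let ?R = "hole_region (c i) (d i) (g i) (h i)" and ?K = "hole_curve (c i) (d i) (g i) (h i)"
  have hole: "is_hole a b F (c i) (d i) (g i) (h i)"
    and le: "\<forall>x\<in>{c i..d i}. g i x \<le> h i x"
    and path: "\<exists>\<gamma>. path \<gamma> \<and> pathfinish \<gamma> = pathstart \<gamma> \<and> path_image \<gamma> = ?K"
    and inside: "inside ?K = ?R"
    and card: "\<forall>x\<in>{c i<..<d i}. card {y. (x, y) \<in> ?K} = 2"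
    using H i by (auto simp: holes_of_def)
  show "F \<in> svf_Lip a b L" "0 < L" by fact+
  show "c i < d i" "{c i..d i} \<subseteq> {a..b}" "g i (c i) = h i (c i)" "g i (d i) = h i (d i)"
    "\<And>x. x \<in> {c i..d i} \<Longrightarrow> g i x \<in> F x" "\<And>x. x \<in> {c i..d i} \<Longrightarrow> h i x \<in> F x"
    using hole by (auto simp: is_hole_def)
  show "closed ?K"
    using path compact_path_image compact_imp_closed by metis
  then show "open ?R"
    using open_inside inside by metis
  show "g i x < h i x" if x: "x \<in> {c i<..<d i}" for x
  proof -
    have "{y. (x, y) \<in> ?K} = {g i x, h i x}"
      using x by (auto simp: hole_curve_def)
    then have "g i x \<noteq> h i x" using card x by fastforce
    then show ?thesis using le x by (simp add: less_le)
  qed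
  show "y \<notin> F x" if "(x, y) \<in> ?R" for x y
  proof -
    have "(x, y) \<in> (\<Union>i<M. hole_region (c i) (d i) (g i) (h i))" using that i by blast
    then have "(x, y) \<in> {(x, y). x \<in> {a..b} \<and> lower_bd F x \<le> y \<and> y \<le> upper_bd F x} - svf_graph a b F"
      using H unfolding holes_of_def by metis
    then show ?thesis by (auto simp: svf_graph_def)
  qed
qed

lemma svf_eq_interval_minus_gaps:
  assumes F: "F \<in> svf_Lip a b L" "0 < L" and H: "holes_of a b F M c d g h" and t: "t \<in> {a..b}"
  shows "F t = {lower_bd F t..upper_bd F t} - (\<Union>i\<in>{i. i < M \<and> t \<in> {c i..d i}}. {g i t<..<h i t})"
proof -
  have eq: "{(x, y). x \<in> {a..b} \<and> lower_bd F x \<le> y \<and> y \<le> upper_bd F x} - svf_graph a b F =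
       (\<Union>i<M. hole_region (c i) (d i) (g i) (h i))"
    using H by (simp add: holes_of_def)
  have "y \<in> F t \<longleftrightarrow> lower_bd F t \<le> y \<and> y \<le> upper_bd F t \<and>
      \<not> (\<exists>i<M. (t, y) \<in> hole_region (c i) (d i) (g i) (h i))" for y
    using svf_bounds(3,4)[of F t y] svf_Lip_Kstar[OF F(1) t] t eqset_imp_iff[OF eq, of "(t, y)"]
    by (auto simp: svf_graph_def)
  \<comment> \<open>The regions live over open intervals, the index set uses closed ones; at both
    ends g = h, so the additional gaps are empty.\<close>
  moreover have "(t, y) \<in> hole_region (c i) (d i) (g i) (h i) \<longleftrightarrow>
      t \<in> {c i..d i} \<and> y \<in> {g i t<..<h i t}" if "i < M" for i y
    using svf_hole.gh_ends[OF holes_of_svf_hole[OF F H that]]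
    by (auto simp: hole_region_def less_le)
  ultimately show ?thesis by auto
qed

text \<open>The filter \<open>at_right 0\<close> combines finitely many radii, with no special case
  for an empty index set.\<close>

lemma finite_uniform_positive:
  fixes P :: "'a \<Rightarrow> real \<Rightarrow> bool"
  assumes "finite A" and ex: "\<And>i. i \<in> A \<Longrightarrow> \<exists>r>0. P i r"
    and mono: "\<And>i r s. P i r \<Longrightarrow> s \<le> r \<Longrightarrow> P i s"
  obtains r where "0 < r" "\<And>i. i \<in> A \<Longrightarrow> P i r"
proof -
  have "\<forall>\<^sub>F s in at_right 0. \<forall>i\<in>A. P i s"
  proof (rule eventually_ball_finite[OF \<open>finite A\<close>], intro ballI)
    fix i assume "i \<in> A"
    then obtain r where "0 < r" "P i r" using ex by blast
    then show "\<forall>\<^sub>F s in at_right 0. P i s"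
      unfolding eventually_at_right_field using mono by (intro exI[of _ r]) (auto intro: less_imp_le)
  qed
  then obtain r where "0 < r" "\<forall>s>0. s < r \<longrightarrow> (\<forall>i\<in>A. P i s)"
    unfolding eventually_at_right_field by blast
  then show ?thesis using that[of "r / 2"] by auto
qed

text \<open>Compactness turns disjointness into positive distance. The sum of coordinate distances
  dominates the Euclidean distance and keeps horizontal and vertical errors apart in later
  estimates.\<close>

lemma holes_separated:
  assumes F: "F \<in> svf_Lip a b L" "0 < L" and H: "holes_of a b F M c d g h"
  obtains r where "0 < r"
    "\<And>i s. i < M \<Longrightarrow> s \<in> {c i..d i} \<Longrightarrow> lower_bd F s + r \<le> g i s \<and> h i s + r \<le> upper_bd F s"
    "\<And>i j s t y z. i < M \<Longrightarrow> j < M \<Longrightarrow> i \<noteq> j \<Longrightarrow> s \<in> {c i..d i} \<Longrightarrow> t \<in> {c j..d j} \<Longrightarrow>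
       y \<in> {g i s..h i s} \<Longrightarrow> z \<in> {g j t..h j t} \<Longrightarrow> r \<le> \<bar>s - t\<bar> + \<bar>y - z\<bar>"
proof -
  note hole = holes_of_svf_hole[OF F H]
  define P where "P i r \<longleftrightarrow> (\<forall>s\<in>{c i..d i}. lower_bd F s + r \<le> g i s \<and> h i s + r \<le> upper_bd F s)" for i r
  define Q where "Q = (\<lambda>(i, j) r. \<forall>s\<in>{c i..d i}. \<forall>t\<in>{c j..d j}. \<forall>y\<in>{g i s..h i s}. \<forall>z\<in>{g j t..h j t}.
      r \<le> \<bar>s - t\<bar> + \<bar>y - z\<bar>)"
  obtain r1 where r1: "0 < r1" "\<And>i. i \<in> {..<M} \<Longrightarrow> P i r1"
  proof (rule finite_uniform_positive[of "{..<M}" P])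
    fix i assume "i \<in> {..<M}"
    then have i: "i < M" by simp
    interpret svf_hole a b L F "c i" "d i" "g i" "h i" by (rule hole[OF i])
    define f where "f s = min (g i s - lower_bd F s) (upper_bd F s - h i s)" for s
    have lip: "L-lipschitz_on {c i..d i} (lower_bd F)" "L-lipschitz_on {c i..d i} (upper_bd F)"
      using lower_bd_Lipschitz[OF F(1)] upper_bd_Lipschitz[OF F(1)] ab L
      by (auto intro!: lipschitz_onI simp: dist_real_def subset_iff)
    have "continuous_on {c i..d i} f"
      unfolding f_def using lip[THEN lipschitz_on_continuous_on]
      by (intro continuous_intros continuous_on_g continuous_on_h)
    then obtain s0 where s0: "s0 \<in> {c i..d i}" "\<forall>s\<in>{c i..d i}. f s0 \<le> f s"
      using continuous_attains_inf[of "{c i..d i}" f] cd by auto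
    have "0 < f s0"
    proof -
      have s0': "s0 \<in> {a..b}" using s0 ab by auto
      have "(s0, upper_bd F s0) \<notin> hole_curve (c i) (d i) (g i) (h i)"
        "(s0, lower_bd F s0) \<notin> hole_curve (c i) (d i) (g i) (h i)"
        using H i s0' by (auto simp: holes_of_def)
      then have "lower_bd F s0 \<noteq> g i s0" "upper_bd F s0 \<noteq> h i s0"
        using s0 by (auto simp: hole_curve_def)
      moreover have "lower_bd F s0 \<le> g i s0" "h i s0 \<le> upper_bd F s0"
        using svf_bounds(3,4)[of F s0] svf_Lip_Kstar[OF F(1) s0'] gF[OF s0(1)] hF[OF s0(1)] by auto
      ultimately show ?thesis by (simp add: f_def)
    qed
    moreover have "P i (f s0)"
      using s0 by (force simp: P_def f_def)
    ultimately show "\<exists>r>0. P i r" by blast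
  qed (force simp: P_def)+
  obtain r2 where r2: "0 < r2" "\<And>x. x \<in> {..<M} \<times> {..<M} - Id \<Longrightarrow> Q x r2"
  proof (rule finite_uniform_positive[of "{..<M} \<times> {..<M} - Id" Q])
    fix x assume "x \<in> {..<M} \<times> {..<M} - Id"
    then obtain i j where ij: "x = (i, j)" "i < M" "j < M" "i \<noteq> j" by auto
    let ?Ri = "closure (hole_region (c i) (d i) (g i) (h i))"
    let ?Rj = "closure (hole_region (c j) (d j) (g j) (h j))"
    have "?Ri \<inter> ?Rj = {}" using H ij by (auto simp: holes_of_def)
    moreover have "compact ?Ri"
      using svf_hole.bounded_hole_region[OF hole[OF ij(2)]] by (simp add: compact_closure)
    ultimately obtain r where r: "0 < r" "\<forall>p\<in>?Ri. \<forall>q\<in>?Rj. r \<le> dist p q"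
      using separate_compact_closed[of ?Ri ?Rj] by auto
    have "r \<le> \<bar>s - t\<bar> + \<bar>y - z\<bar>"
      if "s \<in> {c i..d i}" "t \<in> {c j..d j}" "y \<in> {g i s..h i s}" "z \<in> {g j t..h j t}" for s t y z
    proof -
      have "r \<le> dist (s, y) (t, z)"
        using r(2) svf_hole.closure_hole_region[OF hole[OF ij(2)], of s y]
          svf_hole.closure_hole_region[OF hole[OF ij(3)], of t z] that by auto
      also have "\<dots> \<le> \<bar>s - t\<bar> + \<bar>y - z\<bar>"
        by (simp add: dist_Pair_Pair dist_real_def sqrt_sum_squares_le_sum_abs)
      finally show ?thesis .
    qed
    then show "\<exists>r>0. Q x r" using r(1) by (auto simp: Q_def ij)
  qed (fastforce simp: Q_def)+
  show ?thesis
  proof (rule that[of "min r1 r2"])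
    show "lower_bd F s + min r1 r2 \<le> g i s \<and> h i s + min r1 r2 \<le> upper_bd F s"
      if "i < M" "s \<in> {c i..d i}" for i s
      using r1(2)[of i] that by (force simp: P_def)
    show "min r1 r2 \<le> \<bar>s - t\<bar> + \<bar>y - z\<bar>"
      if "i < M" "j < M" "i \<noteq> j" "s \<in> {c i..d i}" "t \<in> {c j..d j}"
        "y \<in> {g i s..h i s}" "z \<in> {g j t..h j t}" for i j s t y z
    proof -
      have "Q (i, j) r2" using r2(2)[of "(i, j)"] that by auto
      then have "r2 \<le> \<bar>s - t\<bar> + \<bar>y - z\<bar>" using that by (auto simp: Q_def)
      then show ?thesis by simp
    qed
  qed (use r1 r2 in auto)
qed

section \<open>Error of the approximated metric polynomial interpolant\<close>

text \<open>
  The point \<open>s i\<close> is the projection of \<open>t\<close> to \<open>{c i..d i}\<close>.  As \<open>r\<close> exceeds all errors, the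
  approximate gaps over \<open>t\<close> are ordered like the gaps of \<open>F\<close> over the points \<open>s i\<close>.
\<close>

lemma hausdorff_dist_boundary_rep:
  fixes g h g' h' :: "nat \<Rightarrow> real \<Rightarrow> real" and c d c' d' :: "nat \<Rightarrow> real"
    and t :: real and M :: nat
  defines "I \<equiv> {i. i < M \<and> t \<in> {c i..d i}}" and "I' \<equiv> {i. i < M \<and> t \<in> {c' i..d' i}}"
  assumes F: "F \<in> svf_Lip a b L" "0 < L" and H: "holes_of a b F M c d g h" and t: "t \<in> {a..b}"
    and lower: "\<And>i s. i < M \<Longrightarrow> s \<in> {c i..d i} \<Longrightarrow> lower_bd F s + r \<le> g i s"
    and upper: "\<And>i s. i < M \<Longrightarrow> s \<in> {c i..d i} \<Longrightarrow> h i s + r \<le> upper_bd F s"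
    and sep: "\<And>i j s t y z. i < M \<Longrightarrow> j < M \<Longrightarrow> i \<noteq> j \<Longrightarrow> s \<in> {c i..d i} \<Longrightarrow> t \<in> {c j..d j} \<Longrightarrow>
       y \<in> {g i s..h i s} \<Longrightarrow> z \<in> {g j t..h j t} \<Longrightarrow> r \<le> \<bar>s - t\<bar> + \<bar>y - z\<bar>"
    and r: "(L + 4) * e < r"
    and lu: "\<bar>l' t - lower_bd F t\<bar> \<le> e" "\<bar>u' t - upper_bd F t\<bar> \<le> e"
    and cd': "\<And>i. i < M \<Longrightarrow> c' i \<le> c i \<and> d i \<le> d' i"
    and s: "\<And>i. i < M \<Longrightarrow> s i = max (c i) (min (d i) t)"
    and gh': "\<And>i. i \<in> I' \<Longrightarrow> \<bar>t - s i\<bar> \<le> e \<and> \<bar>g' i t - g i (s i)\<bar> \<le> e \<and> \<bar>h' i t - h i (s i)\<bar> \<le> e"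
  shows "hausdorff_dist (boundary_rep l' u' M c' d' g' h' t) (F t) \<le> 3 * e"
proof -
  note hole = holes_of_svf_hole[OF F H]
  have e: "0 \<le> e" using lu by linarith
  have Le: "0 \<le> L * e" using e F by simp
  \<comment> \<open>The outer boundaries need \<open>L * e + 2 * e\<close>: they move by
    \<open>L * e\<close> between \<open>s i\<close> and \<open>t\<close>, and both approximations
    err by \<open>e\<close>. Two holes need \<open>4 * e\<close>: \<open>2 * e\<close> horizontally
    and \<open>e\<close> for either approximate boundary.\<close>
  have r': "L * e + 4 * e < r" using r by (simp add: algebra_simps)
  have sI: "s i \<in> {c i..d i}" "s i \<in> {a..b}" if "i < M" for i
    using s[OF that] svf_hole.cd[OF hole[OF that]] svf_hole.ab[OF hole[OF that]] by auto
  have gh: "g i (s i) \<le> h i (s i)" if "i < M" for i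
    using svf_hole.g_le_h[OF hole[OF that] sI(1)[OF that]] .
  have I_M: "i < M" if "i \<in> I'" for i using that by (simp add: I'_def)
  have I_sub: "I \<subseteq> I'" using cd' by (force simp: I_def I'_def)
  have bd: "l' t < min (g' i t) (h' i t) \<and> max (g' i t) (h' i t) < u' t" if i: "i \<in> I'" for i
  proof -
    have "L * \<bar>t - s i\<bar> \<le> L * e" using gh'[OF i] F by (intro mult_left_mono) auto
    then have "\<bar>lower_bd F t - lower_bd F (s i)\<bar> \<le> L * e" "\<bar>upper_bd F t - upper_bd F (s i)\<bar> \<le> L * e"
      using lower_bd_Lipschitz[OF F(1) t sI(2)[OF I_M[OF i]]]
        upper_bd_Lipschitz[OF F(1) t sI(2)[OF I_M[OF i]]] by auto
    then show ?thesis
      using lower[OF I_M[OF i] sI(1)[OF I_M[OF i]]] upper[OF I_M[OF i] sI(1)[OF I_M[OF i]]]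
        gh[OF I_M[OF i]] gh'[OF i] lu r' e by (auto simp: abs_le_iff)
  qed
  have apart: "max (g' i t) (h' i t) < min (g' j t) (h' j t)"
    if ij: "i \<in> I'" "j \<in> I'" "i \<noteq> j" and le: "g i (s i) \<le> g j (s j)" for i j
  proof -
    note sep' = sep[OF I_M[OF ij(1)] I_M[OF ij(2)] ij(3) sI(1)[OF I_M[OF ij(1)]] sI(1)[OF I_M[OF ij(2)]]]
    have "\<bar>s i - s j\<bar> \<le> 2 * e" using gh'[OF ij(1)] gh'[OF ij(2)] by linarith
    \<comment> \<open>Otherwise the height \<open>g j (s j)\<close> would belong to the sections of
      both holes, at horizontal distance at most \<open>2 * e\<close>.\<close>
    moreover have "h i (s i) < g j (s j)"
    proof (rule ccontr)
      assume "\<not> h i (s i) < g j (s j)"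
      then have "r \<le> \<bar>s i - s j\<bar>"
        using sep'[of "g j (s j)" "g j (s j)"] gh[OF I_M[OF ij(2)]] le by auto
      then show False using \<open>\<bar>s i - s j\<bar> \<le> 2 * e\<close> r' Le e by linarith
    qed
    moreover have "r \<le> \<bar>s i - s j\<bar> + \<bar>h i (s i) - g j (s j)\<bar>"
      using sep'[of "h i (s i)" "g j (s j)"] gh[OF I_M[OF ij(1)]] gh[OF I_M[OF ij(2)]] by auto
    ultimately have "h i (s i) + 2 * e < g j (s j)"
      using r' Le by linarith
    then show ?thesis
      using gh'[OF ij(1)] gh'[OF ij(2)] gh[OF I_M[OF ij(1)]] gh[OF I_M[OF ij(2)]]
      by (auto simp: abs_le_iff)
  qed
  have ordered: "max (g' i t) (h' i t) < min (g' j t) (h' j t) \<or> max (g' j t) (h' j t) < min (g' i t) (h' i t)"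
    if "i \<in> I'" "j \<in> I'" "i \<noteq> j" for i j
    using apart[of i j] apart[of j i] that linear[of "g i (s i)" "g j (s j)"] by blast
  have rep: "boundary_rep l' u' M c' d' g' h' t =
      closed_segment (l' t) (u' t) - (\<Union>i\<in>I'. {g' i t<..<h' i t})"
    unfolding I'_def
    by (rule boundary_rep_eq_segment_minus_gaps; unfold I'_def[symmetric])
       (use ordered bd in \<open>auto intro: less_imp_le\<close>)
  have Ft: "F t = {lower_bd F t..upper_bd F t} - (\<Union>i\<in>I. {g i t<..<h i t})"
    unfolding I_def by (rule svf_eq_interval_minus_gaps[OF F H t])
  note K = svf_bounds[of F t, OF svf_Lip_Kstar[OF F(1) t]]
  show ?thesis
    unfolding rep Ft
  proof (rule hausdorff_dist_segment_minus_gaps; (fold rep Ft)?)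
    show "lower_bd F t \<in> F t" "upper_bd F t \<in> F t" by fact+
    show "g i t \<in> F t \<and> h i t \<in> F t" if "i \<in> I" for i
      using that svf_hole.gF[OF hole] svf_hole.hF[OF hole] by (auto simp: I_def)
    show "I \<subseteq> I'" by fact
    show "\<bar>g' i t - g i t\<bar> \<le> e \<and> \<bar>h' i t - h i t\<bar> \<le> e" if "i \<in> I" for i
    proof -
      have "s i = t" using that s[of i] by (auto simp: I_def)
      then show ?thesis using gh'[of i] that I_sub by auto
    qed
    \<comment> \<open>Outside the hole, \<open>t\<close> projects to one of its ends, where the true
      gap has closed.\<close>
    show "h' i t \<le> g' i t + 2 * e" if "i \<in> I' - I" for i
    proof -
      have "i < M" using that I_M by auto
      then have "s i = c i \<or> s i = d i"
        using that s[of i] by (auto simp: I_def I'_def)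
      then have "g i (s i) = h i (s i)"
        using svf_hole.gh_ends[OF hole[OF \<open>i < M\<close>]] by auto
      then show ?thesis using gh'[of i] that by (auto simp: abs_le_iff)
    qed
    show "g' i t \<in> boundary_rep l' u' M c' d' g' h' t \<and> h' i t \<in> boundary_rep l' u' M c' d' g' h' t"
      if i: "i \<in> I'" for i
    proof -
      have "g' i t \<notin> {g' j t<..<h' j t} \<and> h' i t \<notin> {g' j t<..<h' j t}" if j: "j \<in> I'" for j
      proof (cases "i = j")
        case False
        then show ?thesis using ordered[OF i j] by auto
      qed auto
      then show ?thesis
        unfolding rep using bd[OF i] by (auto simp: closed_segment_eq_real_ivl)
    qed
  qed (use lu in auto)
qed

text \<open>In \<open>e\<close>, 80 L is 76 L + 2 L + 2 L: the interpolation error, and the distance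
  to a node paid once for the data of the polynomial and once for the boundary function. The summand
  2 bounds the shift from \<open>t\<close> to its projection.\<close>

lemma approx_metric_interpolant_error:
  fixes a b L :: real and N :: nat
  defines "e \<equiv> (80 * L + 2) * (b - a) * (ln (real N) / real N)"
  assumes ab: "a < b" and F: "F \<in> svf_Lip a b L" "0 < L" and H: "holes_of a b F M c d g h"
    and lower: "\<And>i s. i < M \<Longrightarrow> s \<in> {c i..d i} \<Longrightarrow> lower_bd F s + r \<le> g i s"
    and upper: "\<And>i s. i < M \<Longrightarrow> s \<in> {c i..d i} \<Longrightarrow> h i s + r \<le> upper_bd F s"
    and sep: "\<And>i j s t y z. i < M \<Longrightarrow> j < M \<Longrightarrow> i \<noteq> j \<Longrightarrow> s \<in> {c i..d i} \<Longrightarrow> t \<in> {c j..d j} \<Longrightarrow>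
       y \<in> {g i s..h i s} \<Longrightarrow> z \<in> {g j t..h j t} \<Longrightarrow> r \<le> \<bar>s - t\<bar> + \<bar>y - z\<bar>"
    and N: "3 \<le> N" and r: "(L + 4) * e < r"
    and G: "approx_metric_interpolant a b F M c d g h N G" and t: "t \<in> {a..b}"
  shows "hausdorff_dist (G t) (F t) \<le> 3 * e"
proof -
  define x where "x = chebyshev_point a b N"
  define nodes where "nodes i = {q. q \<le> N \<and> x q \<in> {c i..d i}}" for i
  define n where "n i = Min (nodes i)" for i
  define m where "m i = Max (nodes i)" for i
  define E where "E = ln (real N) / real N"
  obtain pl pu pg ph where
    nodes: "\<And>i. i < M \<Longrightarrow> nodes i \<noteq> {} \<and> 0 < n i \<and> m i < N"
    and pl: "pl \<in> chain_polys N x (\<lambda>i. F (x i))" "\<And>i. i \<le> N \<Longrightarrow> poly pl (x i) = lower_bd F (x i)"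
    and pu: "pu \<in> chain_polys N x (\<lambda>i. F (x i))" "\<And>i. i \<le> N \<Longrightarrow> poly pu (x i) = upper_bd F (x i)"
    and pgh: "\<And>i. i < M \<Longrightarrow> hole_polys N x (\<lambda>i. F (x i)) (g i) (h i) (n i) (m i) (pg i) (ph i)"
    and Gt: "G t = boundary_rep (poly pl) (poly pu) M (\<lambda>i. x (n i - 1)) (\<lambda>i. x (m i + 1))
                 (\<lambda>i. poly (pg i)) (\<lambda>i. poly (ph i)) t"
    using G t unfolding approx_metric_interpolant_def Let_def x_def nodes_def n_def m_def by blast
  note hole = holes_of_svf_hole[OF F H]
  have E: "0 \<le> E" using ln_ge_one[OF N] by (simp add: E_def)
  have e: "e = 80 * L * (b - a) * E + 2 * (b - a) * E"
    by (simp add: e_def E_def algebra_simps)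
  have parts: "0 \<le> 80 * L * (b - a) * E" "0 \<le> 2 * (b - a) * E"
    using ab F E by auto
  \<comment> \<open>Here \<open>v\<close> stands for the value of a boundary function at a point
    whose distance from the node \<open>x q\<close> is \<open>y\<close>.\<close>
  have near: "\<bar>poly p t - v\<bar> \<le> 80 * L * (b - a) * E"
    if p: "p \<in> chain_polys N x (\<lambda>i. F (x i))" and q: "q \<le> N" "\<bar>t - x q\<bar> \<le> 2 * (b - a) * E"
      and v: "\<bar>poly p (x q) - v\<bar> \<le> L * y" "y \<le> \<bar>t - x q\<bar>" for p q v y
  proof -
    have "\<bar>poly p t - poly p (x q)\<bar> \<le> L * \<bar>t - x q\<bar> + 76 * L * (b - a) * E"
      using chain_poly_error[OF ab F(2) N F(1) _ t q(1)] p by (simp add: x_def E_def)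
    moreover have "L * \<bar>t - x q\<bar> \<le> L * (2 * (b - a) * E)" "L * y \<le> L * \<bar>t - x q\<bar>"
      using q v F by (auto intro!: mult_left_mono)
    ultimately have "\<bar>poly p t - v\<bar> \<le> 2 * (L * (2 * (b - a) * E)) + 76 * L * (b - a) * E"
      using v by linarith
    then show ?thesis by (simp add: algebra_simps)
  qed
  have x_less: "x i < x j" if "i < j" "j \<le> N" for i j
    using chebyshev_point_less[OF ab that] by (simp add: x_def)
  have nm: "n i \<le> m i" "x (n i - 1) < c i" "d i < x (m i + 1)"
    "\<And>q. q \<in> {n i..m i} \<Longrightarrow> q \<le> N \<and> x q \<in> {c i..d i}" if i: "i < M" for i
  proof -
    have fin: "finite (nodes i)" by (simp add: nodes_def)
    then have in_n: "n i \<in> nodes i" and in_m: "m i \<in> nodes i"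
      using nodes[OF i] by (auto simp: n_def m_def)
    show "n i \<le> m i" using fin in_m by (simp add: n_def)
    have "n i - 1 \<notin> nodes i" "m i + 1 \<notin> nodes i"
      using Min_le[OF fin, of "n i - 1"] Max_ge[OF fin, of "m i + 1"] nodes[OF i]
      by (auto simp: n_def m_def)
    moreover have "x (n i - 1) < x (n i)" "x (m i) < x (m i + 1)"
      using x_less[of "n i - 1" "n i"] x_less[of "m i" "m i + 1"] nodes[OF i] in_n
      by (auto simp: nodes_def)
    ultimately show "x (n i - 1) < c i" "d i < x (m i + 1)"
      using in_n in_m nodes[OF i] by (auto simp: nodes_def)
    show "q \<le> N \<and> x q \<in> {c i..d i}" if "q \<in> {n i..m i}" for q
    proof -
      have "x (n i) \<le> x q" "x q \<le> x (m i)"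
        using that chebyshev_point_mono[OF ab] nodes[OF i] by (auto simp: x_def)
      then show ?thesis using in_n in_m that by (auto simp: nodes_def)
    qed
  qed
  define s where "s i = max (c i) (min (d i) t)" for i
  obtain q0 where q0: "q0 \<le> N" "\<bar>t - x q0\<bar> \<le> 2 * (b - a) * E"
    using chebyshev_points_dense[OF ab N t] by (auto simp: x_def E_def)
  have xq0: "x q0 \<in> {a..b}"
    using chebyshev_point_in[OF ab q0(1)] by (simp add: x_def)
  show ?thesis
    unfolding Gt
  proof (rule hausdorff_dist_boundary_rep[OF F H t lower upper sep r])
    show "\<bar>poly pl t - lower_bd F t\<bar> \<le> e"
      using near[OF pl(1) q0, of "lower_bd F t" "\<bar>x q0 - t\<bar>"] lower_bd_Lipschitz[OF F(1) xq0 t]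
        pl(2)[OF q0(1)] parts e by (simp add: abs_minus_commute)
    show "\<bar>poly pu t - upper_bd F t\<bar> \<le> e"
      using near[OF pu(1) q0, of "upper_bd F t" "\<bar>x q0 - t\<bar>"] upper_bd_Lipschitz[OF F(1) xq0 t]
        pu(2)[OF q0(1)] parts e by (simp add: abs_minus_commute)
    show "x (n i - 1) \<le> c i \<and> d i \<le> x (m i + 1)" if "i < M" for i
      using nm[OF that] by simp
    show "s i = max (c i) (min (d i) t)" if "i < M" for i by (simp add: s_def)
    show "\<bar>t - s i\<bar> \<le> e \<and> \<bar>poly (pg i) t - g i (s i)\<bar> \<le> e \<and> \<bar>poly (ph i) t - h i (s i)\<bar> \<le> e"
      if "i \<in> {i. i < M \<and> t \<in> {x (n i - 1)..x (m i + 1)}}" for i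
    proof -
      from that have i: "i < M" and ti: "x (n i - 1) \<le> t" "t \<le> x (m i + 1)" by auto
      interpret h: svf_hole a b L F "c i" "d i" "g i" "h i" by (rule hole[OF i])
      obtain q where q: "q \<in> {n i..m i}" "\<bar>t - x q\<bar> \<le> 2 * (b - a) * E"
        using chebyshev_point_near_between[OF ab N, of "n i" "m i" t] nodes[OF i] nm(1)[OF i] ti
        by (auto simp: x_def E_def)
      have xq: "q \<le> N" "x q \<in> {c i..d i}" using nm(4)[OF i q(1)] by auto
      have si: "s i \<in> {c i..d i}" using h.cd by (auto simp: s_def)
      \<comment> \<open>Of the points of \<open>{c i..d i}\<close>, among them \<open>x q\<close>,
        the projection \<open>s i\<close> is nearest to \<open>t\<close>; it is also no further from
        \<open>x q\<close> than \<open>t\<close> is.\<close>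
      have proj: "\<bar>t - s i\<bar> \<le> \<bar>t - x q\<bar>" "\<bar>x q - s i\<bar> \<le> \<bar>t - x q\<bar>"
        using xq(2) by (auto simp: s_def)
      have P: "pg i \<in> chain_polys N x (\<lambda>i. F (x i))" "ph i \<in> chain_polys N x (\<lambda>i. F (x i))"
        "poly (pg i) (x q) = g i (x q)" "poly (ph i) (x q) = h i (x q)"
        using pgh[OF i] q(1) by (auto simp: hole_polys_def)
      have "\<bar>poly (pg i) t - g i (s i)\<bar> \<le> 80 * L * (b - a) * E"
        using near[OF P(1) xq(1) q(2), of "g i (s i)" "\<bar>x q - s i\<bar>"] h.g_Lipschitz[OF xq(2) si] P(3) proj
        by simp
      moreover have "\<bar>poly (ph i) t - h i (s i)\<bar> \<le> 80 * L * (b - a) * E"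
        using near[OF P(2) xq(1) q(2), of "h i (s i)" "\<bar>x q - s i\<bar>"] h.h_Lipschitz[OF xq(2) si] P(4) proj
        by simp
      ultimately show ?thesis using e parts proj q(2) by linarith
    qed
  qed
qed

theorem theorem3p2:
  fixes a b L :: real and M :: nat and F :: "real \<Rightarrow> real set"
    and c d :: "nat \<Rightarrow> real" and g h :: "nat \<Rightarrow> real \<Rightarrow> real"
  assumes "a < b" and "L > 0"
    and "F \<in> svf_Lip a b L \<inter> svf_class a b M"
    and "holes_of a b F M c d g h"
  shows "\<exists>C. \<forall>\<^sub>F N in sequentially.
           \<forall>G. approx_metric_interpolant a b F M c d g h N G \<longrightarrow>
             (\<forall>x\<in>{a..b}. hausdorff_dist (G x) (F x) \<le> C * (ln (real N) / real N))"
proof -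
  let ?K = "(80 * L + 2) * (b - a)"
  have F: "F \<in> svf_Lip a b L" using assms(3) by simp
  obtain r where r: "0 < r"
    and bd: "\<And>i s. i < M \<Longrightarrow> s \<in> {c i..d i} \<Longrightarrow> lower_bd F s + r \<le> g i s \<and> h i s + r \<le> upper_bd F s"
    and sep: "\<And>i j s t y z. i < M \<Longrightarrow> j < M \<Longrightarrow> i \<noteq> j \<Longrightarrow> s \<in> {c i..d i} \<Longrightarrow> t \<in> {c j..d j} \<Longrightarrow>
       y \<in> {g i s..h i s} \<Longrightarrow> z \<in> {g j t..h j t} \<Longrightarrow> r \<le> \<bar>s - t\<bar> + \<bar>y - z\<bar>"
    using holes_separated[OF F assms(2,4)] by metis
  \<comment> \<open>The separation \<open>r\<close> only decides from which \<open>N\<close> on the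
    bound holds; the final constant \<open>3 * ?K\<close> depends on \<open>L\<close> and
    \<open>b - a\<close> alone.\<close>
  have "(\<lambda>N. (L + 4) * (?K * (ln (real N) / real N))) \<longlonglongrightarrow> (L + 4) * (?K * 0)"
    by (intro tendsto_intros)
  then have "\<forall>\<^sub>F N in sequentially. (L + 4) * (?K * (ln (real N) / real N)) < r"
    using r by (intro order_tendstoD(2)) auto
  then have "\<forall>\<^sub>F N in sequentially. \<forall>G. approx_metric_interpolant a b F M c d g h N G \<longrightarrow>
      (\<forall>x\<in>{a..b}. hausdorff_dist (G x) (F x) \<le> 3 * ?K * (ln (real N) / real N))"
    using eventually_ge_at_top[of 3]
  proof eventually_elim
    case (elim N)
    show ?case
    proof (intro allI impI ballI)
      fix G x assume "approx_metric_interpolant a b F M c d g h N G" "x \<in> {a..b}"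
      then have "hausdorff_dist (G x) (F x) \<le> 3 * (?K * (ln (real N) / real N))"
        using bd by (intro approx_metric_interpolant_error[OF assms(1) F assms(2,4) _ _ sep elim(2,1)]) auto
      then show "hausdorff_dist (G x) (F x) \<le> 3 * ?K * (ln (real N) / real N)" by (simp only: mult.assoc)
    qed
  qed
  then show ?thesis by blast
qed

end
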